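(* Let $\alpha,\beta\in\mathbb{Z}$ and let $L$ be a linear form on $L^2(\mathbb{T})$ (not assumed continuous). Then the following hold. (i) If $L$ is $(\alpha,\beta)$-invariant on $L^2(\mathbb{T})$, then $L$ is continuous on $L^2(\mathbb{T})$. Thus, in this case there is a function $h\in L^2(\mathbb{T})$ such that $L(f)=\int_{\mathbb{T}}f\,\overline h\,d\mu_{\mathbb{T}}$ for all $f\in L^2(\mathbb{T})$. (ii) If $h\in L^2(\mathbb{T})$, the linear form on $L^2(\mathbb{T})$ given by $f\mapsto\int_{\mathbb{T}}f\,\overline h\,d\mu_{\mathbb{T}}$ is $(\alpha,\beta)$-invariant if and only if there are $c_1,c_2\in\mathbb{C}$ such that $h(z)=c_1z^{\alpha}+c_2z^{\beta}$ for almost all $z\in\mathbb{T}$. (iii) If $L$ is a translation invariant linear form on $L^2(\mathbb{T})$, then $L$ is a multiple of the Haar measure on $\mathbb{T}$; that is, there is $c\in\mathbb{C}$ with $L(f)=c\int_{\mathbb{T}}f\,d\mu_{\mathbb{T}}$ for all $f\in L^2(\mathbb{T})$.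
   Context: $\mathbb{T}=\{z\in\mathbb{C}:|z|=1\}$ is the circle group and $\mu_{\mathbb{T}}$ its normalised Haar measure. For $z\in\mathbb{T}$ and $\nu\in\mathbb{R}$, write $z=e^{it}$ uniquely with $t\in[0,2\pi)$ and put $z^{\nu}=e^{it\nu}$. $\delta_b$ is the Dirac measure at $b\in\mathbb{T}$ and $\ast$ denotes convolution on $\mathbb{T}$, so $(\delta_b\ast f)(z)=f(b^{-1}z)$. A linear form $L$ on $L^2(\mathbb{T})$ is called $(\alpha,\beta)$-invariant if, for all $b\in\mathbb{T}$ and $f\in L^2(\mathbb{T})$, $$L\left[\left(b^{(\alpha+\beta)/2}\delta_b+b^{-(\alpha+\beta)/2}\delta_{b^{-1}}\right)\ast f\right]=\bigl(b^{(\alpha-\beta)/2}+b^{-(\alpha-\beta)/2}\bigr)L(f).$$ $L$ is called translation invariant if $L(\delta_b\ast f)=L(f)$ for all $b\in\mathbb{T}$ and $f\in L^2(\mathbb{T})$. *)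

theory Defs
  imports "HOL-Analysis.Analysis"
begin

abbreviation circle :: "complex set"
  where "circle \<equiv> sphere 0 1"

(* Normalised Haar measure, as the image of the uniform distribution on [0,2 pi).  That this is
   the normalised Haar measure is emeasure_haar_circle_space and distr_haar_circle below. *)
definition haar_circle :: "complex measure"
  where "haar_circle =
    distr (uniform_measure lborel {0..<2 * pi}) (restrict_space borel circle) cis"

(* For z = exp(i t) on the circle with 0 <= t < 2 pi this is exp(i t nu), since Arg2pi z = t. *)
definition circle_powr :: "complex \<Rightarrow> real \<Rightarrow> complex"
  where "circle_powr z \<nu> = cis (\<nu> * Arg2pi z)"

(* Representatives of the elements of the Hilbert space; the identification of functions that
   agree almost everywhere is made in linear_form_L2. *)
definition L2_circle :: "(complex \<Rightarrow> complex) set"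
  where "L2_circle = {f \<in> borel_measurable haar_circle. integrable haar_circle (\<lambda>z. (cmod (f z))\<^sup>2)}"

definition L2_norm :: "(complex \<Rightarrow> complex) \<Rightarrow> real"
  where "L2_norm f = sqrt (LINT z|haar_circle. (cmod (f z))\<^sup>2)"

(* The first clause says that L descends to classes of functions modulo equality almost everywhere. *)
definition linear_form_L2 :: "((complex \<Rightarrow> complex) \<Rightarrow> complex) \<Rightarrow> bool"
  where "linear_form_L2 L \<longleftrightarrow>
    (\<forall>f\<in>L2_circle. \<forall>g\<in>L2_circle. (AE z in haar_circle. f z = g z) \<longrightarrow> L f = L g) \<and>
    (\<forall>f\<in>L2_circle. \<forall>g\<in>L2_circle. L (\<lambda>z. f z + g z) = L f + L g) \<and>
    (\<forall>c. \<forall>f\<in>L2_circle. L (\<lambda>z. c * f z) = c * L f)"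

definition continuous_L2 :: "((complex \<Rightarrow> complex) \<Rightarrow> complex) \<Rightarrow> bool"
  where "continuous_L2 L \<longleftrightarrow>
    (\<forall>f\<in>L2_circle. \<forall>e>0. \<exists>d>0. \<forall>g\<in>L2_circle.
       L2_norm (\<lambda>z. g z - f z) < d \<longrightarrow> cmod (L g - L f) < e)"

(* Convolution of f with the Dirac measure at b. *)
definition dirac_conv :: "complex \<Rightarrow> (complex \<Rightarrow> complex) \<Rightarrow> complex \<Rightarrow> complex"
  where "dirac_conv b f = (\<lambda>z. f (inverse b * z))"

definition invariant_form :: "real \<Rightarrow> real \<Rightarrow> ((complex \<Rightarrow> complex) \<Rightarrow> complex) \<Rightarrow> bool"
  where "invariant_form \<alpha> \<beta> L \<longleftrightarrow>
    (\<forall>b\<in>circle. \<forall>f\<in>L2_circle.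
       L (\<lambda>z. circle_powr b ((\<alpha> + \<beta>) / 2) * dirac_conv b f z
            + circle_powr b (- ((\<alpha> + \<beta>) / 2)) * dirac_conv (inverse b) f z)
       = (circle_powr b ((\<alpha> - \<beta>) / 2) + circle_powr b (- ((\<alpha> - \<beta>) / 2))) * L f)"

definition translation_invariant_form :: "((complex \<Rightarrow> complex) \<Rightarrow> complex) \<Rightarrow> bool"
  where "translation_invariant_form L \<longleftrightarrow>
    (\<forall>b\<in>circle. \<forall>f\<in>L2_circle. L (dirac_conv b f) = L f)"

lemma space_haar_circle [simp]: "space haar_circle = circle"
  by (simp add: haar_circle_def space_restrict_space)

lemma sets_haar_circle [measurable_cong]: "sets haar_circle = sets (restrict_space borel circle)"
  by (simp add: haar_circle_def)

lemma measurable_cis_circle: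
  "cis \<in> measurable (uniform_measure lborel {0..<2 * pi}) (restrict_space borel circle)"
proof -
  have "cis \<in> borel_measurable borel"
    by (intro borel_measurable_continuous_onI continuous_on_cis continuous_on_id)
  moreover have "measurable (uniform_measure lborel {0..<2 * pi}) borel
      = (borel_measurable borel :: (real \<Rightarrow> complex) set)"
    by (rule measurable_cong_sets) simp_all
  ultimately have "cis \<in> borel_measurable (uniform_measure lborel {0..<2 * pi})"
    by blast
  then show ?thesis
    by (intro measurable_restrict_space2) auto
qed

lemma emeasure_haar_circle:
  assumes "A \<in> sets haar_circle"
  shows "emeasure haar_circle A = emeasure lborel ({0..<2 * pi} \<inter> cis -` A) / ennreal (2 * pi)"
proof -
  have "cis -` A \<in> sets borel"
    using measurable_sets[OF measurable_cis_circle, of A] assms by (simp add: sets_haar_circle)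
  then show ?thesis
    using assms measurable_cis_circle
    by (simp add: haar_circle_def emeasure_distr sets_haar_circle)
qed

lemma emeasure_haar_circle_space: "emeasure haar_circle circle = 1"
proof -
  have 1: "circle \<in> sets haar_circle"
    using sets.top[of haar_circle] by simp
  have 2: "cis -` circle = UNIV" by auto
  show ?thesis unfolding emeasure_haar_circle[OF 1] 2
    by (simp add: ennreal_divide_self)
qed

lemma emeasure_lborel_shift:
  fixes P :: "real set"
  assumes "P \<in> sets borel"
  shows "emeasure lborel {t. t + s \<in> P} = emeasure lborel P"
proof -
  have "emeasure lborel P = emeasure (distr lborel borel ((+) s)) P"
    by (simp add: lborel_distr_plus)
  also have "\<dots> = emeasure lborel {t. t + s \<in> P}"
    using assms by (subst emeasure_distr) (auto simp: vimage_def add.commute)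
  finally show ?thesis by simp
qed

lemma emeasure_periodic_shift:
  fixes P :: "real set"
  assumes P: "P \<in> sets borel" and per: "\<And>t. t + 2 * pi \<in> P \<longleftrightarrow> t \<in> P"
    and s: "0 \<le> s" "s < 2 * pi"
  shows "emeasure lborel ({0..<2 * pi} \<inter> {t. t + s \<in> P}) = emeasure lborel ({0..<2 * pi} \<inter> P)"
proof -
  have "emeasure lborel ({0..<2 * pi} \<inter> {t. t + s \<in> P})
      = emeasure lborel {t. t + s \<in> {s..<2 * pi + s} \<inter> P}"
    by (rule arg_cong[where f = "emeasure lborel"]) auto
  also have "\<dots> = emeasure lborel ({s..<2 * pi + s} \<inter> P)"
    using P by (intro emeasure_lborel_shift) auto
  also have "{s..<2 * pi + s} \<inter> P = ({s..<2 * pi} \<inter> P) \<union> ({2 * pi..<2 * pi + s} \<inter> P)"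
    using s by auto
  also have "emeasure lborel \<dots>
      = emeasure lborel ({s..<2 * pi} \<inter> P) + emeasure lborel ({2 * pi..<2 * pi + s} \<inter> P)"
    using P by (intro plus_emeasure[symmetric]) auto
  also have "emeasure lborel ({2 * pi..<2 * pi + s} \<inter> P)
      = emeasure lborel {t. t + 2 * pi \<in> {2 * pi..<2 * pi + s} \<inter> P}"
    using P by (intro emeasure_lborel_shift[symmetric]) auto
  also have "{t. t + 2 * pi \<in> {2 * pi..<2 * pi + s} \<inter> P} = {0..<s} \<inter> P"
    using per by auto
  also have "emeasure lborel ({s..<2 * pi} \<inter> P) + emeasure lborel ({0..<s} \<inter> P)
      = emeasure lborel (({s..<2 * pi} \<inter> P) \<union> ({0..<s} \<inter> P))"
    using P by (intro plus_emeasure) auto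
  also have "({s..<2 * pi} \<inter> P) \<union> ({0..<s} \<inter> P) = {0..<2 * pi} \<inter> P"
    using s by auto
  finally show ?thesis .
qed

lemma measurable_mult_circle:
  assumes "b \<in> circle"
  shows "(\<lambda>z. b * z) \<in> measurable haar_circle haar_circle"
proof -
  have "(\<lambda>z. b * z) \<in> borel_measurable borel" by measurable
  then have "(\<lambda>z. b * z) \<in> measurable (restrict_space borel circle) (restrict_space borel circle)"
    using assms
    by (intro measurable_restrict_space2 measurable_restrict_space1)
       (auto simp: space_restrict_space norm_mult)
  then show ?thesis
    using measurable_cong_sets[OF sets_haar_circle sets_haar_circle] by blast
qed

lemma distr_haar_circle:
  assumes b: "b \<in> circle"
  shows "distr haar_circle haar_circle (\<lambda>z. b * z) = haar_circle"
proof (rule measure_eqI)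
  fix A assume "A \<in> sets (distr haar_circle haar_circle (\<lambda>z. b * z))"
  then have A: "A \<in> sets haar_circle" by simp
  have m: "(\<lambda>z. b * z) -` A \<inter> circle \<in> sets haar_circle"
    using measurable_sets[OF measurable_mult_circle[OF b] A] by simp
  have cb: "cis (Arg2pi b) = b"
    using b Arg2pi_eq[of b] by (simp add: cis_conv_exp)
  have P: "cis -` A \<in> sets borel"
    using measurable_sets[OF measurable_cis_circle, of A] A by (simp add: sets_haar_circle)
  have per: "t + 2 * pi \<in> cis -` A \<longleftrightarrow> t \<in> cis -` A" for t
    by (simp add: cis_mult[symmetric])
  have "cis -` ((\<lambda>z. b * z) -` A \<inter> circle) = {t. t + Arg2pi b \<in> cis -` A}"
  proof -
    have "b * cis t = cis (t + Arg2pi b)" for t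
      by (metis cb cis_mult mult.commute)
    then show ?thesis by auto
  qed
  then have "emeasure haar_circle ((\<lambda>z. b * z) -` A \<inter> circle) = emeasure haar_circle A"
    using emeasure_periodic_shift[OF P per Arg2pi_ge_0 Arg2pi_lt_2pi, of b]
    by (simp only: emeasure_haar_circle[OF m] emeasure_haar_circle[OF A])
  then show "emeasure (distr haar_circle haar_circle (\<lambda>z. b * z)) A = emeasure haar_circle A"
    using A measurable_mult_circle[OF b] by (simp add: emeasure_distr)
qed simp

lemma dirac_conv_L2:
  assumes b: "b \<in> circle" and f: "f \<in> L2_circle"
  shows "dirac_conv b f \<in> L2_circle"
proof -
  have ib: "inverse b \<in> circle" using b by (simp add: norm_inverse)
  note m = measurable_mult_circle[OF ib]
  have fm: "f \<in> borel_measurable haar_circle"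
    and fi: "integrable haar_circle (\<lambda>z. (cmod (f z))\<^sup>2)"
    using f by (auto simp: L2_circle_def)
  have "integrable haar_circle (\<lambda>z. (cmod (f (inverse b * z)))\<^sup>2)"
    using fi m by (subst (asm) distr_haar_circle[OF ib, symmetric]) (rule integrable_distr)
  then show ?thesis
    using measurable_compose[OF m fm] by (simp add: L2_circle_def dirac_conv_def)
qed

lemma integrable_pairing:
  assumes f: "f \<in> L2_circle" and h: "h \<in> L2_circle"
  shows "integrable haar_circle (\<lambda>z. f z * cnj (h z))"
proof (rule Bochner_Integration.integrable_bound)
  show "integrable haar_circle (\<lambda>z. (cmod (f z))\<^sup>2 + (cmod (h z))\<^sup>2)"
    using f h by (simp add: L2_circle_def)
  have [measurable]: "f \<in> borel_measurable haar_circle" "h \<in> borel_measurable haar_circle"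
    using f h by (auto simp: L2_circle_def)
  have [measurable]: "cnj \<in> borel_measurable borel"
    by (intro borel_measurable_continuous_onI continuous_on_cnj continuous_on_id)
  show "(\<lambda>z. f z * cnj (h z)) \<in> borel_measurable haar_circle"
    by measurable
  have "x * y \<le> x\<^sup>2 + y\<^sup>2" if "0 \<le> x" "0 \<le> y" for x y :: real
    using sum_squares_bound[of x y] mult_nonneg_nonneg[OF that] by linarith
  then show "AE z in haar_circle. norm (f z * cnj (h z)) \<le> norm ((cmod (f z))\<^sup>2 + (cmod (h z))\<^sup>2)"
    by (simp add: norm_mult)
qed

lemma linear_form_pairing:
  assumes h: "h \<in> L2_circle"
  shows "linear_form_L2 (\<lambda>f. LINT z|haar_circle. f z * cnj (h z))"
  unfolding linear_form_L2_def
proof (intro conjI ballI allI impI)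
  fix f g assume f: "f \<in> L2_circle" and g: "g \<in> L2_circle"
  show "(LINT z|haar_circle. (f z + g z) * cnj (h z))
    = (LINT z|haar_circle. f z * cnj (h z)) + (LINT z|haar_circle. g z * cnj (h z))"
    using integrable_pairing[OF f h] integrable_pairing[OF g h]
    by (simp add: distrib_right)
  assume "AE z in haar_circle. f z = g z"
  then show "(LINT z|haar_circle. f z * cnj (h z)) = (LINT z|haar_circle. g z * cnj (h z))"
    using integrable_pairing[OF f h] integrable_pairing[OF g h]
    by (intro integral_cong_AE) auto
next
  fix c f
  show "(LINT z|haar_circle. (c * f z) * cnj (h z)) = c * (LINT z|haar_circle. f z * cnj (h z))"
    by (simp add: mult.assoc)
qed

end

theory Submission
  imports Defs "HOL-Probability.Probability_Measure"
begin

text \<open>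
  A form is \<open>(\<alpha>, \<beta>)\<close>-invariant if and only if it vanishes on certain functions, called invariance
  defects below. Forming the defect of \<open>f\<close> at \<open>b = cis t\<close> multiplies the \<open>n\<close>-th Fourier coefficient of
  \<open>f\<close> by a real number \<open>M t n\<close> with \<open>\<bar>M t n\<bar> = 4 * \<bar>sin ((n - \<alpha>) * t / 2)\<bar> * \<bar>sin ((n - \<beta>) * t / 2)\<bar>\<close>.
  The core of the proof (\<open>invariant_form_eq_0\<close>) is that every square-integrable \<open>f\<close> whose coefficients
  at \<open>\<alpha>\<close> and \<open>\<beta>\<close> vanish is a sum of eight invariance defects. Every invariant form, continuous or not,
  is therefore zero at such an \<open>f\<close>, so it is a linear combination of the coefficients at \<open>\<alpha>\<close> and \<open>\<beta>\<close>.
  Continuity and the representing function can be read off. The same result, applied to the form given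
  by \<open>h\<close>, determines \<open>h\<close>, and translation invariant forms are covered by \<open>\<alpha> = \<beta> = 0\<close>.

  For the core statement it suffices to find \<open>t 0, \<dots>, t 7\<close> such that the squares of the coefficients
  of \<open>f\<close> remain summable over \<open>n\<close> after division by the maximum over \<open>j\<close> of \<open>(M (t j) n)\<^sup>2\<close>: then the
  quotients of the coefficients by that \<open>M (t j) n\<close> which is largest in absolute value are the Fourier
  coefficients of functions \<open>g 0, \<dots>, g 7\<close>, by \<open>Riesz_Fischer\<close>, and \<open>f\<close> is the sum of their defects
  because Fourier coefficients determine a function (\<open>fourier_coeff_zero_AE\<close>). The points are chosen
  one after the other. The integral of \<open>\<bar>M t n\<bar>\<close> to the power \<open>-1/4\<close> over \<open>0 \<le> t < 2 * pi\<close> is bounded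
  uniformly in \<open>n \<noteq> \<alpha>, \<beta>\<close>, because \<open>1 / sqrt \<bar>sin (t / 2)\<bar>\<close> is integrable and dilation by a nonzero
  integer preserves its integral. By Tonelli, for any summable weights that vanish at \<open>\<alpha>\<close> and \<open>\<beta>\<close> some
  \<open>t\<close> keeps the weights summable after multiplication by this power. Eight rounds of multiplication
  dominate the division by the square of the largest \<open>\<bar>M (t j) n\<bar>\<close>.
\<close>

section \<open>Fourier coefficients on the circle\<close>

text \<open>The conjugate of a character is kept in the form \<open>cnj (z powi n)\<close> in which it occurs in Fourier
  coefficients.\<close>
declare complex_cnj_power_int [simp del]

lemma prob_space_haar_circle: "prob_space haar_circle"
  using emeasure_haar_circle_space by (intro prob_spaceI) simp

interpretation haar: prob_space haar_circle
  by (rule prob_space_haar_circle)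

lemma measurable_haar_circleI:
  fixes f :: "complex \<Rightarrow> 'a::topological_space"
  assumes "f \<in> borel_measurable borel"
  shows "f \<in> borel_measurable haar_circle"
  using measurable_restrict_space1[OF assms, of circle]
  by (simp cong: measurable_cong_sets add: sets_haar_circle)

lemma measurable_powi [measurable]: "(\<lambda>z::complex. z powi n) \<in> borel_measurable haar_circle"
  by (rule measurable_haar_circleI) (simp add: power_int_def)

lemma measurable_cnj [measurable]: "cnj \<in> borel_measurable borel"
  by (intro borel_measurable_continuous_onI continuous_on_cnj continuous_on_id)

lemma integrable_mult_bounded:
  fixes f g :: "complex \<Rightarrow> complex"
  assumes "integrable haar_circle f" "g \<in> borel_measurable haar_circle"
    "\<And>z. z \<in> circle \<Longrightarrow> cmod (g z) \<le> B"
  shows "integrable haar_circle (\<lambda>z. f z * g z)"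
proof (rule Bochner_Integration.integrable_bound)
  show "integrable haar_circle (\<lambda>z. B * cmod (f z))"
    using assms(1) by simp
  show "AE z in haar_circle. norm (f z * g z) \<le> norm (B * cmod (f z))"
  proof (rule AE_I2)
    fix z assume "z \<in> space haar_circle"
    then have "cmod (g z) \<le> B" using assms(3) by simp
    then have "cmod (g z) \<le> \<bar>B\<bar>" by linarith
    from mult_left_mono[OF this norm_ge_zero[of "f z"]]
    show "norm (f z * g z) \<le> norm (B * cmod (f z))"
      by (simp add: norm_mult abs_mult mult.commute)
  qed
qed (use assms in measurable)

lemma integral_rotate:
  fixes f :: "complex \<Rightarrow> complex"
  assumes "f \<in> borel_measurable haar_circle" and "b \<in> circle"
  shows "(LINT z|haar_circle. f (b * z)) = (LINT z|haar_circle. f z)"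
  using integral_distr[OF measurable_mult_circle[OF assms(2)] assms(1)]
  by (simp add: distr_haar_circle[OF assms(2)])

lemma circle_cnj: "z \<in> circle \<Longrightarrow> cnj z = inverse z"
  by (simp add: inverse_eq_divide divide_conv_cnj)

lemma integral_powi: "(LINT z|haar_circle. z powi n) = (if n = 0 then 1 else 0)"
proof (cases "n = 0")
  case True
  then show ?thesis using haar.prob_space by simp
next
  case False
  \<comment> \<open>Translating by \<open>b\<close> with \<open>b powi n = -1\<close> changes the sign of the integral.\<close>
  define b where "b = cis (pi / of_int n)"
  have "b powi n = -1"
    using False unfolding b_def by (simp add: cis_power_int)
  then have "(LINT z|haar_circle. z powi n) = - (LINT z|haar_circle. z powi n)"
    using integral_rotate[OF measurable_powi, of b n]
    by (simp add: power_int_mult_distrib b_def)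
  then show ?thesis using False by simp
qed

text \<open>The coefficient of \<open>f\<close> against the character \<open>z \<mapsto> z\<^sup>n\<close>.\<close>
definition fourier_coeff :: "(complex \<Rightarrow> complex) \<Rightarrow> int \<Rightarrow> complex"
  where "fourier_coeff f n = (LINT z|haar_circle. f z * cnj (z powi n))"

lemma L2_measurable: "f \<in> L2_circle \<Longrightarrow> f \<in> borel_measurable haar_circle"
  by (simp add: L2_circle_def)

lemma L2_bounded:
  assumes "f \<in> borel_measurable haar_circle" "\<And>z. z \<in> circle \<Longrightarrow> cmod (f z) \<le> B"
  shows "f \<in> L2_circle"
proof -
  have "cmod (f z) ^ 2 \<le> B ^ 2" if "z \<in> circle" for z
    using assms(2)[OF that] by (intro power_mono) auto
  then show ?thesis
    using assms(1) by (auto simp: L2_circle_def intro!: haar.integrable_const_bound[of _ "B^2"])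
qed

lemma L2_powi: "(\<lambda>z. z powi n) \<in> L2_circle"
  by (rule L2_bounded[where B = 1]) (auto simp: norm_power_int)

lemma L2_cmult:
  assumes "f \<in> L2_circle" shows "(\<lambda>z. c * f z) \<in> L2_circle"
  using assms by (auto simp: L2_circle_def norm_mult power_mult_distrib)

lemma L2_add:
  assumes "f \<in> L2_circle" "g \<in> L2_circle"
  shows "(\<lambda>z. f z + g z) \<in> L2_circle"
proof -
  have [measurable]: "f \<in> borel_measurable haar_circle" "g \<in> borel_measurable haar_circle"
    using assms by (auto simp: L2_circle_def)
  have "integrable haar_circle (\<lambda>z. (cmod (f z + g z))\<^sup>2)"
  proof (rule Bochner_Integration.integrable_bound)
    show "integrable haar_circle (\<lambda>z. 2 * (cmod (f z))\<^sup>2 + 2 * (cmod (g z))\<^sup>2)"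
      using assms by (simp add: L2_circle_def)
    have "(cmod (f z + g z))\<^sup>2 \<le> 2 * (cmod (f z))\<^sup>2 + 2 * (cmod (g z))\<^sup>2" for z
    proof -
      have "(cmod (f z + g z))\<^sup>2 \<le> (cmod (f z) + cmod (g z))\<^sup>2"
        by (intro power_mono norm_triangle_ineq) auto
      also have "\<dots> \<le> 2 * (cmod (f z))\<^sup>2 + 2 * (cmod (g z))\<^sup>2"
        using zero_le_power2[of "cmod (f z) - cmod (g z)"] by (simp add: power2_eq_square algebra_simps)
      finally show ?thesis .
    qed
    then show "AE z in haar_circle. norm ((cmod (f z + g z))\<^sup>2)
        \<le> norm (2 * (cmod (f z))\<^sup>2 + 2 * (cmod (g z))\<^sup>2)"
      by (intro AE_I2) simp
  qed simp
  then show ?thesis by (simp add: L2_circle_def)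
qed

lemma L2_diff:
  assumes "f \<in> L2_circle" "g \<in> L2_circle"
  shows "(\<lambda>z. f z - g z) \<in> L2_circle"
  using L2_add[OF assms(1) L2_cmult[OF assms(2), of "-1"]] by simp

lemma L2_sum:
  assumes "\<And>i. i \<in> I \<Longrightarrow> f i \<in> L2_circle"
  shows "(\<lambda>z. \<Sum>i\<in>I. f i z) \<in> L2_circle"
  using assms
proof (induction I rule: infinite_finite_induct)
  case (insert i I)
  then show ?case using L2_add[of "f i"] by simp
qed (auto intro: L2_bounded[where B = 0])

lemma L2_integrable: "f \<in> L2_circle \<Longrightarrow> integrable haar_circle f"
  using integrable_pairing[OF _ L2_powi[of 0]] by simp

lemma integrable_mult_powi:
  assumes "integrable haar_circle f"
  shows "integrable haar_circle (\<lambda>z. f z * cnj (z powi n))"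
  using assms by (rule integrable_mult_bounded[where B = 1]) (auto simp: norm_power_int)

lemma fourier_coeff_add:
  "f \<in> L2_circle \<Longrightarrow> g \<in> L2_circle \<Longrightarrow>
    fourier_coeff (\<lambda>z. f z + g z) n = fourier_coeff f n + fourier_coeff g n"
  using integrable_mult_powi[OF L2_integrable, of f n] integrable_mult_powi[OF L2_integrable, of g n]
  by (simp add: fourier_coeff_def distrib_right)

lemma fourier_coeff_diff:
  "f \<in> L2_circle \<Longrightarrow> g \<in> L2_circle \<Longrightarrow>
    fourier_coeff (\<lambda>z. f z - g z) n = fourier_coeff f n - fourier_coeff g n"
  using integrable_mult_powi[OF L2_integrable, of f n] integrable_mult_powi[OF L2_integrable, of g n]
  by (simp add: fourier_coeff_def left_diff_distrib)

lemma fourier_coeff_cmult: "fourier_coeff (\<lambda>z. c * f z) n = c * fourier_coeff f n"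
  by (simp add: fourier_coeff_def mult.assoc)

lemma fourier_coeff_sum:
  assumes "\<And>i. i \<in> I \<Longrightarrow> f i \<in> L2_circle"
  shows "fourier_coeff (\<lambda>z. \<Sum>i\<in>I. f i z) n = (\<Sum>i\<in>I. fourier_coeff (f i) n)"
  using assms
proof (induction I rule: infinite_finite_induct)
  case (insert i I)
  then show ?case by (simp add: fourier_coeff_add L2_sum)
qed (simp_all add: fourier_coeff_def)

lemma powi_mult_cnj_powi:
  assumes "z \<in> circle" shows "z powi m * cnj (z powi n) = z powi (m - n)"
proof -
  have "z \<noteq> 0" using assms by auto
  then show ?thesis
    using assms circle_cnj[of "z powi n"] by (simp add: power_int_diff divide_inverse norm_power_int)
qed

lemma fourier_coeff_powi: "fourier_coeff (\<lambda>z. z powi m) n = (if m = n then 1 else 0)"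
proof -
  have "fourier_coeff (\<lambda>z. z powi m) n = (LINT z|haar_circle. z powi (m - n))"
    unfolding fourier_coeff_def by (rule Bochner_Integration.integral_cong) (auto simp: powi_mult_cnj_powi)
  then show ?thesis by (simp add: integral_powi)
qed

lemma fourier_coeff_dirac_conv:
  assumes f: "f \<in> L2_circle" and b: "b \<in> circle"
  shows "fourier_coeff (dirac_conv b f) n = b powi (- n) * fourier_coeff f n"
proof -
  have [measurable]: "f \<in> borel_measurable haar_circle" by (rule L2_measurable[OF f])
  have b0: "b \<noteq> 0" using b by auto
  have "(\<lambda>z. f z * cnj ((b * z) powi n)) \<in> borel_measurable haar_circle"
    unfolding power_int_mult_distrib by measurable
  from integral_rotate[OF this, of "inverse b"]
  have "fourier_coeff (dirac_conv b f) n = (LINT z|haar_circle. f z * cnj ((b * z) powi n))"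
    using b b0 by (simp add: fourier_coeff_def dirac_conv_def norm_inverse mult.assoc[symmetric])
  also have "\<dots> = (LINT z|haar_circle. cnj (b powi n) * (f z * cnj (z powi n)))"
    by (simp add: power_int_mult_distrib mult_ac)
  also have "\<dots> = cnj (b powi n) * fourier_coeff f n"
    by (simp add: fourier_coeff_def)
  also have "cnj (b powi n) = b powi (- n)"
    using b circle_cnj[of "b powi n"] by (simp add: power_int_minus norm_power_int)
  finally show ?thesis .
qed

text \<open>The distance from \<open>f\<close> to a trigonometric polynomial. Bessel's inequality is the case of the partial
  sums of the Fourier series of \<open>f\<close>, and \<open>f = 0\<close> gives the norm of a trigonometric polynomial.\<close>
lemma integral_norm_sq_powi_sum_diff:
  assumes f: "f \<in> L2_circle" and F: "finite F"
  shows "(LINT z|haar_circle. (cmod (f z - (\<Sum>n\<in>F. d n * z powi n)))\<^sup>2)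
    = (LINT z|haar_circle. (cmod (f z))\<^sup>2) - 2 * Re (\<Sum>n\<in>F. cnj (d n) * fourier_coeff f n)
      + (\<Sum>n\<in>F. (cmod (d n))\<^sup>2)"
proof -
  define s where "s = (\<lambda>z. \<Sum>n\<in>F. d n * z powi n)"
  have s: "s \<in> L2_circle"
    unfolding s_def by (intro L2_sum L2_cmult L2_powi)
  have pair_s: "(LINT z|haar_circle. g z * cnj (s z)) = (\<Sum>n\<in>F. cnj (d n) * fourier_coeff g n)"
    if g: "g \<in> L2_circle" for g
  proof -
    have "g z * cnj (s z) = (\<Sum>n\<in>F. cnj (d n) * (g z * cnj (z powi n)))" for z
      by (simp add: s_def sum_distrib_left mult_ac)
    then show ?thesis
      using integrable_mult_powi[OF L2_integrable[OF g]]
      by (simp add: fourier_coeff_def)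
  qed
  have cs: "fourier_coeff s n = d n" if "n \<in> F" for n
    using that F unfolding s_def
    by (simp add: fourier_coeff_sum L2_cmult L2_powi fourier_coeff_cmult fourier_coeff_powi if_distrib cong: if_cong)
  have pt: "complex_of_real ((cmod (f z - s z))\<^sup>2)
     = complex_of_real ((cmod (f z))\<^sup>2) - f z * cnj (s z) - cnj (f z * cnj (s z)) + s z * cnj (s z)" for z
    unfolding complex_norm_square by (simp add: algebra_simps)
  have int: "integrable haar_circle (\<lambda>z. f z * cnj (s z))" "integrable haar_circle (\<lambda>z. s z * cnj (s z))"
    "integrable haar_circle (\<lambda>z. complex_of_real ((cmod (f z))\<^sup>2))"
    using integrable_pairing[OF f s] integrable_pairing[OF s s] f
    by (auto simp: L2_circle_def simp del: of_real_power)
  have "complex_of_real (LINT z|haar_circle. (cmod (f z - s z))\<^sup>2)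
     = (LINT z|haar_circle. complex_of_real ((cmod (f z - s z))\<^sup>2))"
    by (simp del: of_real_power)
  also have "\<dots> = complex_of_real (LINT z|haar_circle. (cmod (f z))\<^sup>2)
      - (LINT z|haar_circle. f z * cnj (s z)) - cnj (LINT z|haar_circle. f z * cnj (s z))
      + (LINT z|haar_circle. s z * cnj (s z))"
    unfolding pt using int
    by (simp del: of_real_power complex_cnj_mult complex_cnj_cnj)
  also have "(LINT z|haar_circle. s z * cnj (s z)) = complex_of_real (\<Sum>n\<in>F. (cmod (d n))\<^sup>2)"
    by (simp add: pair_s[OF s] cs complex_norm_square mult.commute del: of_real_power)
  finally have "complex_of_real (LINT z|haar_circle. (cmod (f z - s z))\<^sup>2)
     = complex_of_real ((LINT z|haar_circle. (cmod (f z))\<^sup>2)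
        - 2 * Re (\<Sum>n\<in>F. cnj (d n) * fourier_coeff f n) + (\<Sum>n\<in>F. (cmod (d n))\<^sup>2))"
    unfolding pair_s[OF f] by (simp add: complex_eq_iff del: of_real_power)
  then show ?thesis
    unfolding of_real_eq_iff s_def .
qed

lemma integral_norm_sq_powi_sum:
  assumes F: "finite F"
  shows "(LINT z|haar_circle. (cmod (\<Sum>n\<in>F. d n * z powi n))\<^sup>2) = (\<Sum>n\<in>F. (cmod (d n))\<^sup>2)"
  using integral_norm_sq_powi_sum_diff[OF L2_bounded[where f="\<lambda>_. 0" and B=0] F, of d]
  by (simp add: fourier_coeff_def)

lemma Bessel_inequality:
  assumes f: "f \<in> L2_circle" and F: "finite F"
  shows "(\<Sum>n\<in>F. (cmod (fourier_coeff f n))\<^sup>2) \<le> (LINT z|haar_circle. (cmod (f z))\<^sup>2)"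
proof -
  have "Re (\<Sum>n\<in>F. cnj (fourier_coeff f n) * fourier_coeff f n) = (\<Sum>n\<in>F. (cmod (fourier_coeff f n))\<^sup>2)"
    unfolding cmod_power2 by (simp add: power2_eq_square)
  moreover have "0 \<le> (LINT z|haar_circle. (cmod (f z - (\<Sum>n\<in>F. fourier_coeff f n * z powi n)))\<^sup>2)"
    by simp
  ultimately show ?thesis
    unfolding integral_norm_sq_powi_sum_diff[OF f F] by simp
qed

lemma fourier_coeff_summable:
  assumes "f \<in> L2_circle"
  shows "(\<lambda>n. (cmod (fourier_coeff f n))\<^sup>2) summable_on UNIV"
  using Bessel_inequality[OF assms]
  by (intro nonneg_bdd_above_summable_on bdd_aboveI[of _ "LINT z|haar_circle. (cmod (f z))\<^sup>2"]) auto

section \<open>The Riesz--Fischer theorem\<close>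

text \<open>On a probability space, the \<open>L\<^sup>1\<close>-norm is at most the \<open>L\<^sup>2\<close>-norm.\<close>
lemma integral_norm_le_integral_norm_sq:
  assumes f: "f \<in> L2_circle" and a: "0 < a"
    and le: "(LINT z|haar_circle. (cmod (f z))\<^sup>2) \<le> a\<^sup>2"
  shows "(LINT z|haar_circle. cmod (f z)) \<le> a"
proof -
  have "2 * a * (LINT z|haar_circle. cmod (f z)) = (LINT z|haar_circle. 2 * a * cmod (f z))"
    by simp
  also have "\<dots> \<le> (LINT z|haar_circle. (cmod (f z))\<^sup>2 + a\<^sup>2)"
  proof (rule integral_mono)
    show "integrable haar_circle (\<lambda>z. 2 * a * cmod (f z))"
      using L2_integrable[OF f] by simp
    show "integrable haar_circle (\<lambda>z. (cmod (f z))\<^sup>2 + a\<^sup>2)"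
      using f by (simp add: L2_circle_def)
    show "2 * a * cmod (f z) \<le> (cmod (f z))\<^sup>2 + a\<^sup>2" for z
      using sum_squares_bound[of "cmod (f z)" a] by (simp add: mult_ac)
  qed
  also have "\<dots> = (LINT z|haar_circle. (cmod (f z))\<^sup>2) + a\<^sup>2"
    using f haar.prob_space by (simp add: L2_circle_def)
  also have "\<dots> \<le> 2 * a * a"
    using le by (simp add: power2_eq_square)
  finally show ?thesis using a by simp
qed

text \<open>A summable family splits into finite blocks whose mass decays geometrically. In the
  Riesz--Fischer theorem, this makes the series of the corresponding trigonometric polynomials converge
  absolutely almost everywhere, so that no completeness of the Hilbert space is needed.\<close>
lemma summable_finite_blocks:
  fixes w :: "int \<Rightarrow> real"
  assumes w: "w summable_on UNIV" and nn: "\<And>n. 0 \<le> w n"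
  obtains G :: "nat \<Rightarrow> int set" where "\<And>k. finite (G k)" "disjoint_family G" "(\<Union>k. G k) = UNIV"
    "\<And>k. (\<Sum>n\<in>G (Suc k). w n) \<le> (1/4) ^ k"
proof -
  have "\<exists>F. finite F \<and> infsum w UNIV - (1/4) ^ k \<le> sum w F" for k :: nat
  proof -
    have "(sum w \<longlongrightarrow> infsum w UNIV) (finite_subsets_at_top UNIV)"
      using infsum_tendsto[OF w] .
    then have "\<forall>\<^sub>F F in finite_subsets_at_top UNIV. infsum w UNIV - (1/4) ^ k < sum w F"
      by (rule order_tendstoD) simp
    then show ?thesis
      unfolding eventually_finite_subsets_at_top by (meson less_imp_le order_refl subset_UNIV)
  qed
  then obtain F where F: "\<And>k. finite (F k)" "\<And>k::nat. infsum w UNIV - (1/4) ^ k \<le> sum w (F k)"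
    by metis
  \<comment> \<open>The intervals ensure that the sets cover all integers.\<close>
  define A where "A k = F k \<union> {- int k..int k}" for k
  have finA: "finite (A k)" for k
    using F by (simp add: A_def)
  show ?thesis
  proof (rule that[of "disjointed A"])
    show fin: "finite (disjointed A k)" for k
      using finA[of k] disjointed_subset[of A k] by (rule rev_finite_subset)
    show "disjoint_family (disjointed A)"
      by (rule disjoint_family_disjointed)
    have "n \<in> A (nat \<bar>n\<bar>)" for n
      by (auto simp: A_def)
    then show "(\<Union>k. disjointed A k) = UNIV"
      unfolding UN_disjointed_eq by blast
    show "(\<Sum>n\<in>disjointed A (Suc k). w n) \<le> (1/4) ^ k" for k
    proof -
      have "disjointed A (Suc k) \<inter> F k = {}"
        by (auto simp: disjointed_def A_def)
      then have "(\<Sum>n\<in>disjointed A (Suc k). w n) + sum w (F k)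
          = sum w (disjointed A (Suc k) \<union> F k)"
        using fin F by (intro sum.union_disjoint[symmetric]) auto
      also have "\<dots> \<le> infsum w UNIV"
        using fin F nn w by (intro finite_sum_le_infsum) auto
      finally show ?thesis using F(2)[of k] by simp
    qed
  qed
qed

theorem Riesz_Fischer:
  fixes d :: "int \<Rightarrow> complex"
  assumes d: "(\<lambda>n. (cmod (d n))\<^sup>2) summable_on UNIV"
  obtains g where "g \<in> L2_circle" "\<And>n. fourier_coeff g n = d n"
proof -
  obtain G :: "nat \<Rightarrow> int set" where fin: "\<And>k. finite (G k)" and dis: "disjoint_family G"
    and cov: "(\<Union>k. G k) = UNIV"
    and small: "\<And>k. (\<Sum>n\<in>G (Suc k). (cmod (d n))\<^sup>2) \<le> (1/4) ^ k"
    using summable_finite_blocks[OF d] by auto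
  define u where "u k = (\<lambda>z. \<Sum>n\<in>G k. d n * z powi n)" for k
  have u: "u k \<in> L2_circle" for k
    unfolding u_def by (intro L2_sum L2_cmult L2_powi)
  have [measurable]: "u k \<in> borel_measurable haar_circle" for k
    using u by (rule L2_measurable)
  have "(LINT z|haar_circle. cmod (u (Suc k) z)) \<le> (1/2) ^ k" for k
  proof (rule integral_norm_le_integral_norm_sq[OF u])
    have "((1/2) ^ k)\<^sup>2 = (1/4::real) ^ k"
      by (simp add: power_mult_distrib[symmetric] power2_eq_square)
    then show "(LINT z|haar_circle. (cmod (u (Suc k) z))\<^sup>2) \<le> ((1/2) ^ k)\<^sup>2"
      using small[of k] unfolding u_def by (simp add: integral_norm_sq_powi_sum[OF fin])
  qed simp
  then have "summable (\<lambda>k. LINT z|haar_circle. cmod (u (Suc k) z))"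
    by (intro summable_comparison_test'[OF summable_geometric[of "1/2"], where N = 0]) simp_all
  then have sum_int: "summable (\<lambda>k. LINT z|haar_circle. cmod (u k z))"
    by (rule iffD1[OF summable_Suc_iff])
  have "(\<integral>\<^sup>+z. (\<Sum>k. ennreal (cmod (u k z))) \<partial>haar_circle) = (\<Sum>k. \<integral>\<^sup>+z. ennreal (cmod (u k z)) \<partial>haar_circle)"
    by (rule nn_integral_suminf) simp
  also have "\<dots> = (\<Sum>k. ennreal (LINT z|haar_circle. cmod (u k z)))"
    using L2_integrable[OF u] by (intro suminf_cong nn_integral_eq_integral) auto
  also have "\<dots> \<noteq> \<infinity>"
    unfolding infinity_ennreal_def by (rule ennreal_suminf_neq_top[OF sum_int]) simp
  finally have "AE z in haar_circle. (\<Sum>k. ennreal (cmod (u k z))) \<noteq> \<infinity>"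
    by (intro nn_integral_PInf_AE) auto
  then have ae: "AE z in haar_circle. summable (\<lambda>k. cmod (u k z))"
    by eventually_elim (rule summable_suminf_not_top, auto)
  define g where "g z = (\<Sum>k. u k z)" for z
  have [measurable]: "g \<in> borel_measurable haar_circle"
    unfolding g_def by measurable
  have part: "(LINT z|haar_circle. (cmod (\<Sum>k<m. u k z))\<^sup>2) \<le> infsum (\<lambda>n. (cmod (d n))\<^sup>2) UNIV" for m
  proof -
    have "(\<Sum>k<m. u k z) = (\<Sum>n\<in>(\<Union>k<m. G k). d n * z powi n)" for z
      unfolding u_def using fin dis
      by (subst sum.UNION_disjoint) (auto simp: disjoint_family_on_def)
    then show ?thesis
      using integral_norm_sq_powi_sum[of "\<Union>k<m. G k" d] fin d
      by (simp add: finite_sum_le_infsum)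
  qed
  \<comment> \<open>Square-integrability of the sum is Fatou's lemma for the partial sums.\<close>
  have "(\<integral>\<^sup>+z. ennreal ((cmod (g z))\<^sup>2) \<partial>haar_circle)
     = (\<integral>\<^sup>+z. liminf (\<lambda>m. ennreal ((cmod (\<Sum>k<m. u k z))\<^sup>2)) \<partial>haar_circle)"
  proof (rule nn_integral_cong_AE, use ae in eventually_elim)
    fix z assume "summable (\<lambda>k. cmod (u k z))"
    then have "(\<lambda>m. \<Sum>k<m. u k z) \<longlonglongrightarrow> g z"
      unfolding g_def by (rule summable_LIMSEQ[OF summable_norm_cancel])
    then have "(\<lambda>m. ennreal ((cmod (\<Sum>k<m. u k z))\<^sup>2)) \<longlonglongrightarrow> ennreal ((cmod (g z))\<^sup>2)"
      by (intro tendsto_intros)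
    then show "ennreal ((cmod (g z))\<^sup>2) = liminf (\<lambda>m. ennreal ((cmod (\<Sum>k<m. u k z))\<^sup>2))"
      by (intro lim_imp_Liminf[symmetric]) auto
  qed
  also have "\<dots> \<le> liminf (\<lambda>m. \<integral>\<^sup>+z. ennreal ((cmod (\<Sum>k<m. u k z))\<^sup>2) \<partial>haar_circle)"
    by (rule nn_integral_liminf) simp
  also have "\<dots> \<le> liminf (\<lambda>m::nat. ennreal (infsum (\<lambda>n. (cmod (d n))\<^sup>2) UNIV))"
  proof (intro Liminf_mono always_eventually allI)
    fix m
    have "integrable haar_circle (\<lambda>z. (cmod (\<Sum>k<m. u k z))\<^sup>2)"
      using L2_sum[of "{..<m}" u] u by (simp add: L2_circle_def)
    then show "(\<integral>\<^sup>+z. ennreal ((cmod (\<Sum>k<m. u k z))\<^sup>2) \<partial>haar_circle) \<le> ennreal (infsum (\<lambda>n. (cmod (d n))\<^sup>2) UNIV)"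
      using part[of m] by (subst nn_integral_eq_integral) (auto intro: ennreal_leI)
  qed
  also have "\<dots> < \<infinity>" by (simp add: Liminf_const)
  finally have g: "g \<in> L2_circle"
    unfolding L2_circle_def by (auto intro!: integrableI_bounded)
  moreover have "fourier_coeff g m = d m" for m
  proof -
    define v where "v k z = u k z * cnj (z powi m)" for k z
    have "(\<lambda>k. LINT z|haar_circle. v k z) sums (LINT z|haar_circle. (\<Sum>k. v k z))"
    proof (rule sums_integral)
      show "integrable haar_circle (v k)" for k
        unfolding v_def by (intro integrable_mult_powi L2_integrable u)
      show "AE z in haar_circle. summable (\<lambda>k. norm (v k z))"
        using ae by eventually_elim (simp add: v_def norm_mult summable_mult2)
      have "(LINT z|haar_circle. norm (v k z)) = (LINT z|haar_circle. norm (u k z))" for k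
        by (rule Bochner_Integration.integral_cong) (auto simp: v_def norm_mult norm_power_int)
      then show "summable (\<lambda>k. LINT z|haar_circle. norm (v k z))"
        using sum_int by simp
    qed
    moreover have "(LINT z|haar_circle. (\<Sum>k. v k z)) = fourier_coeff g m"
      unfolding fourier_coeff_def
    proof (rule integral_cong_AE)
      show "AE z in haar_circle. (\<Sum>k. v k z) = g z * cnj (z powi m)"
        using ae
      proof eventually_elim
        case (elim z)
        then show ?case
          unfolding v_def g_def by (rule suminf_mult2[OF summable_norm_cancel, symmetric])
      qed
    qed (auto simp: v_def)
    moreover have "(LINT z|haar_circle. v k z) = (if m \<in> G k then d m else 0)" for k
    proof -
      have "(LINT z|haar_circle. v k z) = fourier_coeff (u k) m"
        by (simp add: fourier_coeff_def v_def)
      also have "\<dots> = (\<Sum>n\<in>G k. d n * (if n = m then 1 else 0))"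
        unfolding u_def by (simp add: fourier_coeff_sum L2_cmult L2_powi fourier_coeff_cmult fourier_coeff_powi)
      also have "\<dots> = (if m \<in> G k then d m else 0)"
        using fin by (simp add: if_distrib cong: if_cong)
      finally show ?thesis .
    qed
    ultimately have s: "(\<lambda>k. if m \<in> G k then d m else 0) sums fourier_coeff g m"
      by simp
    \<comment> \<open>Only the block that contains \<open>m\<close> contributes.\<close>
    obtain k where k: "m \<in> G k" using cov by blast
    have "m \<in> G i \<longleftrightarrow> i = k" for i
      using k dis by (auto simp: disjoint_family_on_def)
    then have "(\<lambda>i. if m \<in> G i then d m else 0) sums d m"
      using sums_single[of k "\<lambda>_. d m"] by simp
    with s show ?thesis by (rule sums_unique2)
  qed
  ultimately show ?thesis by (rule that)
qed

section \<open>Fourier coefficients determine the function\<close>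

lemma measurable_poly_circle:
  assumes "real_polynomial_function p"
  shows "(\<lambda>z. complex_of_real (p z)) \<in> borel_measurable haar_circle"
  using continuous_on_polymonial_function[of p UNIV] assms
  by (intro measurable_haar_circleI borel_measurable_continuous_onI continuous_intros)
     (simp add: real_polynomial_function_eq)

text \<open>The integrable functions whose Fourier coefficients all vanish form a module over the polynomials
  in the real and imaginary parts: a real-linear function is a combination of \<open>z\<close> and \<open>cnj z\<close>, and on
  the circle multiplication by these shifts the coefficients. This is why the induction hypothesis has to
  be available for all \<open>f\<close>.\<close>
lemma fourier_coeff_zero_mult_poly:
  assumes "real_polynomial_function p" "integrable haar_circle f" "\<And>n. fourier_coeff f n = 0"
  shows "integrable haar_circle (\<lambda>z. f z * complex_of_real (p z))
    \<and> (\<forall>n. fourier_coeff (\<lambda>z. f z * complex_of_real (p z)) n = 0)"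
  using assms
proof (induction p arbitrary: f)
  case (linear h)
  have h: "h z = Re z * h 1 + Im z * h \<i>" for z
  proof -
    interpret bounded_linear h by fact
    have "z = Re z *\<^sub>R 1 + Im z *\<^sub>R \<i>" by (simp add: complex_eq_iff)
    then have "h z = h (Re z *\<^sub>R 1 + Im z *\<^sub>R \<i>)" by simp
    then show ?thesis by (simp only: add scaleR) simp
  qed
  define A B where "A = (h 1 - \<i> * h \<i>) / 2" and "B = (h 1 + \<i> * h \<i>) / 2"
  have hAB: "complex_of_real (h z) = A * z + B * cnj z" for z
    by (subst h) (simp add: A_def B_def complex_eq_iff field_simps)
  have bnd: "cmod (complex_of_real (h z)) \<le> cmod A + cmod B" if "z \<in> circle" for z
    using that norm_triangle_ineq[of "A * z" "B * cnj z"] unfolding hAB by (simp add: norm_mult)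
  have "fourier_coeff (\<lambda>z. f z * complex_of_real (h z)) n = 0" for n
  proof -
    have "fourier_coeff (\<lambda>z. f z * complex_of_real (h z)) n
       = (LINT z|haar_circle. A * (f z * cnj (z powi (n - 1))) + B * (f z * cnj (z powi (n + 1))))"
      unfolding fourier_coeff_def
    proof (rule Bochner_Integration.integral_cong)
      fix z assume "z \<in> space haar_circle"
      then have z: "cmod z = 1" "z \<noteq> 0" by auto
      have "z * cnj z = 1" using z by (simp add: complex_norm_square[symmetric])
      then have "cnj (z powi n) = cnj (z powi (n - 1)) * cnj z" "cnj (z powi (n + 1)) = cnj (z powi n) * cnj z"
        "z * cnj z = 1"
        using z by (simp_all add: power_int_add power_int_diff)
      then show "f z * complex_of_real (h z) * cnj (z powi n)
          = A * (f z * cnj (z powi (n - 1))) + B * (f z * cnj (z powi (n + 1)))"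
        unfolding hAB by algebra
    qed simp
    also have "\<dots> = A * fourier_coeff f (n - 1) + B * fourier_coeff f (n + 1)"
      unfolding fourier_coeff_def using linear.prems(1) by (simp add: integrable_mult_powi)
    finally show ?thesis using linear.prems(2) by simp
  qed
  moreover have "integrable haar_circle (\<lambda>z. f z * complex_of_real (h z))"
    using linear.hyps bnd
    by (intro integrable_mult_bounded[OF linear.prems(1)] measurable_poly_circle) auto
  ultimately show ?case by blast
next
  case (const c)
  then show ?case
    by (simp add: mult.commute[of _ "complex_of_real c"] fourier_coeff_cmult)
next
  case (add p q)
  have "fourier_coeff (\<lambda>z. f z * complex_of_real (p z) + f z * complex_of_real (q z)) n
     = fourier_coeff (\<lambda>z. f z * complex_of_real (p z)) n + fourier_coeff (\<lambda>z. f z * complex_of_real (q z)) n" for n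
    using add.IH[OF add.prems] unfolding fourier_coeff_def distrib_right
    by (intro Bochner_Integration.integral_add integrable_mult_powi) auto
  then show ?case
    using add.IH[OF add.prems] by (simp add: distrib_left)
next
  case (mult p q)
  have "integrable haar_circle (\<lambda>z. (f z * complex_of_real (p z)) * complex_of_real (q z))
    \<and> (\<forall>n. fourier_coeff (\<lambda>z. (f z * complex_of_real (p z)) * complex_of_real (q z)) n = 0)"
    using mult.IH(1)[OF mult.prems] by (intro mult.IH(2)) auto
  then show ?case by (simp add: mult.assoc)
qed

text \<open>Stone--Weierstrass passes from polynomials to continuous functions.\<close>
lemma fourier_coeff_zero_continuous:
  assumes f: "integrable haar_circle f" "\<And>n. fourier_coeff f n = 0"
    and \<phi>: "continuous_on circle \<phi>" and \<phi>m: "\<phi> \<in> borel_measurable haar_circle"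
  shows "(LINT z|haar_circle. f z * complex_of_real (\<phi> z)) = 0"
proof -
  have le: "cmod (LINT z|haar_circle. f z * complex_of_real (\<phi> z)) \<le> e * (LINT z|haar_circle. cmod (f z))"
    if e: "e > 0" for e
  proof -
    obtain p where p: "real_polynomial_function p" "\<And>z. z \<in> circle \<Longrightarrow> \<bar>\<phi> z - p z\<bar> < e"
      using Stone_Weierstrass_real_polynomial_function[OF compact_sphere \<phi> e] by blast
    have ip: "integrable haar_circle (\<lambda>z. f z * complex_of_real (p z))"
      "(LINT z|haar_circle. f z * complex_of_real (p z)) = 0"
      using fourier_coeff_zero_mult_poly[OF p(1) f] by (auto simp: fourier_coeff_def dest: spec[of _ 0])
    have bd: "cmod (complex_of_real (\<phi> z) - complex_of_real (p z)) \<le> e" if "z \<in> circle" for z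
      using p(2)[OF that] by (simp add: of_real_diff[symmetric] del: of_real_diff)
    have "(\<lambda>z. complex_of_real (\<phi> z) - complex_of_real (p z)) \<in> borel_measurable haar_circle"
      using measurable_poly_circle[OF p(1)] \<phi>m by measurable
    from integrable_mult_bounded[OF f(1) this bd]
    have i: "integrable haar_circle (\<lambda>z. f z * (complex_of_real (\<phi> z) - complex_of_real (p z)))" .
    have "(LINT z|haar_circle. f z * complex_of_real (\<phi> z))
      = (LINT z|haar_circle. f z * (complex_of_real (\<phi> z) - complex_of_real (p z)) + f z * complex_of_real (p z))"
      by (simp add: algebra_simps)
    also have "\<dots> = (LINT z|haar_circle. f z * (complex_of_real (\<phi> z) - complex_of_real (p z)))"
      using i ip by simp
    also have "cmod \<dots> \<le> (LINT z|haar_circle. cmod (f z * (complex_of_real (\<phi> z) - complex_of_real (p z))))"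
      by (rule integral_norm_bound)
    also have "\<dots> \<le> (LINT z|haar_circle. e * cmod (f z))"
    proof (rule integral_mono[OF integrable_norm[OF i]])
      fix z assume "z \<in> space haar_circle"
      then have "cmod (complex_of_real (\<phi> z) - complex_of_real (p z)) \<le> e" using bd by simp
      from mult_right_mono[OF this norm_ge_zero[of "f z"]]
      show "norm (f z * (complex_of_real (\<phi> z) - complex_of_real (p z))) \<le> e * cmod (f z)"
        by (simp add: norm_mult mult.commute)
    qed (use f in simp)
    finally show ?thesis by simp
  qed
  define C where "C = (LINT z|haar_circle. cmod (f z))"
  have C: "0 \<le> C" by (simp add: C_def)
  have "cmod (LINT z|haar_circle. f z * complex_of_real (\<phi> z)) \<le> 0 + e" if "e > 0" for e
  proof -
    have "e / (C + 1) * C \<le> e" using that C by (simp add: field_simps)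
    moreover have "e / (C + 1) > 0" using that C by simp
    ultimately show ?thesis using le[of "e / (C + 1)"] unfolding C_def[symmetric] by linarith
  qed
  then show ?thesis
    using field_le_epsilon[of "cmod (LINT z|haar_circle. f z * complex_of_real (\<phi> z))" 0] by simp
qed

lemma fourier_coeff_zero_closed:
  assumes f: "integrable haar_circle f" "\<And>n. fourier_coeff f n = 0" and S: "closed S"
  shows "(LINT z|haar_circle. f z * indicator S z) = 0"
proof (cases "S = {}")
  case False
  \<comment> \<open>The indicator of \<open>S\<close> is the pointwise limit of powers of a continuous function that is 1
    on \<open>S\<close> and smaller than 1 elsewhere.\<close>
  define \<phi> where "\<phi> k z = (1 / (1 + infdist z S)) ^ k" for k and z :: complex
  have cont: "continuous_on A (\<phi> k)" for k A
  proof -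
    have "1 + infdist z S \<noteq> 0" for z
      using infdist_nonneg[of z S] by linarith
    then show ?thesis unfolding \<phi>_def by (intro continuous_intros) auto
  qed
  have m [measurable]: "\<phi> k \<in> borel_measurable haar_circle" for k
    by (intro measurable_haar_circleI borel_measurable_continuous_onI cont)
  have [measurable]: "f \<in> borel_measurable haar_circle" using f by auto
  have Sm: "indicator S \<in> borel_measurable haar_circle"
    using S by (intro measurable_haar_circleI) measurable
  have bd: "0 \<le> \<phi> k z" "\<phi> k z \<le> 1" for k z
  proof -
    have "1 \<le> 1 + infdist z S"
      using infdist_nonneg[of z S] by linarith
    then show "0 \<le> \<phi> k z" "\<phi> k z \<le> 1"
      by (auto simp: \<phi>_def intro!: power_le_one zero_le_power)
  qed
  have lim: "(\<lambda>k. \<phi> k z) \<longlonglongrightarrow> indicator S z" for z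
  proof (cases "z \<in> S")
    case True then show ?thesis by (simp add: \<phi>_def)
  next
    case z: False
    then have "0 < infdist z S"
      using S False infdist_pos_not_in_closed by blast
    then show ?thesis
      using z unfolding \<phi>_def by (simp add: LIMSEQ_power_zero)
  qed
  have "(\<lambda>k. LINT z|haar_circle. f z * complex_of_real (\<phi> k z)) \<longlonglongrightarrow> (LINT z|haar_circle. f z * indicator S z)"
  proof (rule integral_dominated_convergence[where w = "\<lambda>z. cmod (f z)"])
    show "AE z in haar_circle. (\<lambda>k. f z * complex_of_real (\<phi> k z)) \<longlonglongrightarrow> f z * indicator S z"
    proof (rule AE_I2)
      fix z
      have "(\<lambda>k. f z * complex_of_real (\<phi> k z)) \<longlonglongrightarrow> f z * complex_of_real (indicator S z)"
        by (intro tendsto_intros lim)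
      then show "(\<lambda>k. f z * complex_of_real (\<phi> k z)) \<longlonglongrightarrow> f z * indicator S z"
        by (simp add: of_real_indicator)
    qed
    show "AE z in haar_circle. norm (f z * complex_of_real (\<phi> k z)) \<le> cmod (f z)" for k
      using bd by (intro AE_I2) (simp add: norm_mult mult_left_le)
    show "(\<lambda>z. f z * indicator S z) \<in> borel_measurable haar_circle"
      using Sm by measurable
  qed (use f in auto)
  moreover have "(LINT z|haar_circle. f z * complex_of_real (\<phi> k z)) = 0" for k
    by (rule fourier_coeff_zero_continuous[OF f cont m])
  ultimately show ?thesis using LIMSEQ_unique[OF _ tendsto_const] by simp
qed simp

lemma fourier_coeff_zero_borel:
  assumes f: "integrable haar_circle f" "\<And>n. fourier_coeff f n = 0" and S: "S \<in> sets borel"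
  shows "(LINT z|haar_circle. f z * indicator S z) = 0"
proof -
  have [measurable]: "f \<in> borel_measurable haar_circle" using f by auto
  have im [measurable]: "(indicator T :: complex \<Rightarrow> complex) \<in> borel_measurable haar_circle"
    if "T \<in> sets borel" for T
    using that by (intro measurable_haar_circleI borel_measurable_indicator)
  have int: "integrable haar_circle (\<lambda>z. f z * indicator T z)" if "T \<in> sets borel" for T
    by (rule integrable_mult_bounded[where B = 1, OF f(1) im[OF that]]) (auto simp: indicator_def)
  have "Int_stable (Collect closed)" "Collect closed \<subseteq> Pow UNIV" "S \<in> sigma_sets UNIV (Collect closed)"
    using S by (auto simp: Int_stable_def borel_eq_closed)
  then show ?thesis
  proof (induction S rule: sigma_sets_induct_disjoint)
    case (basic T) then show ?case using fourier_coeff_zero_closed[OF f] by simp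
  next
    case (compl T)
    then have T: "T \<in> sets borel" by (simp add: borel_eq_closed)
    have "(LINT z|haar_circle. f z * indicator (UNIV - T) z)
        = (LINT z|haar_circle. f z - f z * indicator T z)"
      by (rule Bochner_Integration.integral_cong) (auto simp: indicator_def)
    also have "\<dots> = (LINT z|haar_circle. f z) - (LINT z|haar_circle. f z * indicator T z)"
      using f(1) int[OF T] by simp
    also have "\<dots> = 0"
      using compl.IH f(2)[of 0] by (simp add: fourier_coeff_def)
    finally show ?case .
  next
    case (union D)
    then have D: "range D \<subseteq> sets borel" by (simp add: borel_eq_closed)
    have "(\<lambda>k. LINT z|haar_circle. f z * indicator (\<Union>i<k. D i) z)
        \<longlonglongrightarrow> (LINT z|haar_circle. f z * indicator (\<Union>i. D i) z)"
    proof (rule integral_dominated_convergence[where w = "\<lambda>z. cmod (f z)"])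
      have "(\<lambda>k. indicator (\<Union>i<k. D i) z :: complex) \<longlonglongrightarrow> indicator (\<Union>i. D i) z" for z
        by (rule LIMSEQ_indicator_UN)
      then show "AE z in haar_circle. (\<lambda>k. f z * indicator (\<Union>i<k. D i) z) \<longlonglongrightarrow> f z * indicator (\<Union>i. D i) z"
        by (intro AE_I2 tendsto_intros)
      show "(\<lambda>z. f z * indicator (\<Union>i. D i) z) \<in> borel_measurable haar_circle"
        "(\<lambda>z. f z * indicator (\<Union>i<k. D i) z) \<in> borel_measurable haar_circle" for k
        using D by (intro borel_measurable_integrable int; auto)+
    qed (use f in \<open>auto simp: norm_mult indicator_def\<close>)
    moreover have "(LINT z|haar_circle. f z * indicator (\<Union>i<k. D i) z) = 0" for k
    proof -
      have eq: "f z * indicator (\<Union>i<k. D i) z = (\<Sum>i<k. f z * indicator (D i) z)" for z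
      proof -
        have "indicator (\<Union>i<k. D i) z = (\<Sum>i<k. indicator (D i) z :: complex)"
          using union.hyps by (intro indicator_UN_disjoint) (auto simp: disjoint_family_on_def)
        then show ?thesis by (simp only: sum_distrib_left)
      qed
      have "(LINT z|haar_circle. (\<Sum>i<k. f z * indicator (D i) z))
          = (\<Sum>i<k. LINT z|haar_circle. f z * indicator (D i) z)"
        using D by (intro Bochner_Integration.integral_sum int) auto
      then show ?thesis unfolding eq using union.IH by simp
    qed
    ultimately show ?case using LIMSEQ_unique[OF _ tendsto_const] by simp
  qed simp
qed

text \<open>Uniqueness holds for all integrable functions, not only for square-integrable ones.\<close>
theorem fourier_coeff_zero_AE:
  assumes f: "integrable haar_circle f" "\<And>n. fourier_coeff f n = 0"
  shows "AE z in haar_circle. f z = 0"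
proof -
  have zero: "(LINT z|haar_circle. f z * indicator A z) = 0" if "A \<in> sets haar_circle" for A
  proof -
    have "A \<in> sets borel"
      using that by (simp add: sets_haar_circle sets_restrict_space_iff)
    then show ?thesis by (rule fourier_coeff_zero_borel[OF f])
  qed
  have int: "integrable haar_circle (\<lambda>z. f z * indicator A z)" if "A \<in> sets haar_circle" for A
    using integrable_mult_indicator[OF that f(1)] by (simp add: scaleR_conv_of_real of_real_indicator mult.commute)
  have "AE z in haar_circle. Re (f z) = 0"
  proof (rule density_unique_real)
    fix A assume A: "A \<in> sets haar_circle"
    have "(LINT z:A|haar_circle. Re (f z)) = (LINT z|haar_circle. Re (f z * indicator A z))"
      unfolding set_lebesgue_integral_def by (rule Bochner_Integration.integral_cong) (auto simp: indicator_def)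
    also have "\<dots> = Re (LINT z|haar_circle. f z * indicator A z)"
      using int[OF A] by (rule integral_Re)
    finally show "(LINT z:A|haar_circle. Re (f z)) = (LINT z:A|haar_circle. 0)"
      using zero[OF A] by (simp add: set_lebesgue_integral_def)
  qed (use f in auto)
  moreover have "AE z in haar_circle. Im (f z) = 0"
  proof (rule density_unique_real)
    fix A assume A: "A \<in> sets haar_circle"
    have "(LINT z:A|haar_circle. Im (f z)) = (LINT z|haar_circle. Im (f z * indicator A z))"
      unfolding set_lebesgue_integral_def by (rule Bochner_Integration.integral_cong) (auto simp: indicator_def)
    also have "\<dots> = Im (LINT z|haar_circle. f z * indicator A z)"
      using int[OF A] by (rule integral_Im)
    finally show "(LINT z:A|haar_circle. Im (f z)) = (LINT z:A|haar_circle. 0)"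
      using zero[OF A] by (simp add: set_lebesgue_integral_def)
  qed (use f in auto)
  ultimately show ?thesis
    by eventually_elim (simp add: complex_eq_iff)
qed

corollary fourier_coeff_eq_AE:
  assumes "f \<in> L2_circle" "g \<in> L2_circle" "\<And>n. fourier_coeff f n = fourier_coeff g n"
  shows "AE z in haar_circle. f z = g z"
proof -
  have "AE z in haar_circle. f z - g z = 0"
    using assms by (intro fourier_coeff_zero_AE) (auto simp: fourier_coeff_diff L2_integrable)
  then show ?thesis by simp
qed

section \<open>Avoiding small divisors\<close>

text \<open>Multiplication by a positive integer preserves the uniform distribution on a period.\<close>
lemma nn_integral_periodic_scale:
  fixes F :: "real \<Rightarrow> ennreal"
  assumes F [measurable]: "F \<in> borel_measurable borel" and per: "\<And>t. F (t + 2 * pi) = F t"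
    and p: "0 < (p::nat)"
  shows "(\<integral>\<^sup>+t. F (real p * t) * indicator {0..<2*pi} t \<partial>lborel) = (\<integral>\<^sup>+t. F t * indicator {0..<2*pi} t \<partial>lborel)"
proof -
  define I where "I = (\<integral>\<^sup>+t. F t * indicator {0..<2*pi} t \<partial>lborel)"
  have per': "F (2 * pi * real k + t) = F t" for k t
  proof (induction k)
    case (Suc k)
    have "F (2 * pi * real (Suc k) + t) = F ((2 * pi * real k + t) + 2 * pi)"
      by (simp add: algebra_simps)
    then show ?case using Suc by (simp only: per)
  qed simp
  have shift: "(\<integral>\<^sup>+t. F t * indicator {2*pi*real k..<2*pi*real (Suc k)} t \<partial>lborel) = I" for k
  proof -
    have "(\<integral>\<^sup>+t. F t * indicator {2*pi*real k..<2*pi*real (Suc k)} t \<partial>lborel)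
      = (\<integral>\<^sup>+t. F (2*pi*real k + 1 * t) * indicator {2*pi*real k..<2*pi*real (Suc k)} (2*pi*real k + 1 * t) \<partial>lborel)"
      by (subst nn_integral_real_affine[where c = 1 and t = "2*pi*real k"]) auto
    also have "\<dots> = I"
      unfolding I_def by (intro nn_integral_cong) (auto simp: per' indicator_def distrib_left distrib_right)
    finally show ?thesis .
  qed
  have "(\<integral>\<^sup>+t. F t * indicator {0..<2*pi*real m} t \<partial>lborel) = of_nat m * I" for m
  proof (induction m)
    case (Suc m)
    have split: "indicator {0..<b} t = (indicator {0..<a} t + indicator {a..<b} t :: ennreal)"
      if "0 \<le> a" "a \<le> b" for a b t :: real
      using that by (auto simp: indicator_def)
    have "indicator {0..<2*pi*real (Suc m)} t
        = (indicator {0..<2*pi*real m} t + indicator {2*pi*real m..<2*pi*real (Suc m)} t :: ennreal)" for t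
      by (rule split) auto
    then have "(\<integral>\<^sup>+t. F t * indicator {0..<2*pi*real (Suc m)} t \<partial>lborel)
      = (\<integral>\<^sup>+t. F t * indicator {0..<2*pi*real m} t + F t * indicator {2*pi*real m..<2*pi*real (Suc m)} t \<partial>lborel)"
      by (simp add: distrib_left)
    also have "\<dots> = of_nat m * I + I"
      by (subst nn_integral_add) (auto simp: Suc shift simp del: of_nat_Suc)
    finally show ?case by (simp add: distrib_right add.commute)
  qed simp
  then have "of_nat p * I = (\<integral>\<^sup>+t. F t * indicator {0..<2*pi*real p} t \<partial>lborel)"
    by simp
  also have "\<dots> = ennreal \<bar>real p\<bar> * (\<integral>\<^sup>+t. F (0 + real p * t) * indicator {0..<2*pi*real p} (0 + real p * t) \<partial>lborel)"
    using p by (intro nn_integral_real_affine) auto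
  also have "(\<integral>\<^sup>+t. F (0 + real p * t) * indicator {0..<2*pi*real p} (0 + real p * t) \<partial>lborel)
     = (\<integral>\<^sup>+t. F (real p * t) * indicator {0..<2*pi} t \<partial>lborel)"
    using p by (intro nn_integral_cong) (auto simp: indicator_def zero_le_mult_iff mult.commute)
  finally have "of_nat p * I = of_nat p * (\<integral>\<^sup>+t. F (real p * t) * indicator {0..<2*pi} t \<partial>lborel)"
    by (simp add: ennreal_of_nat_eq_real_of_nat)
  then show ?thesis
    using p by (auto simp: ennreal_mult_cancel_left I_def)
qed

lemma inverse_ennreal_antimono:
  assumes "x \<le> y" shows "inverse (ennreal y) \<le> inverse (ennreal x)"
proof (cases "0 < x")
  case True
  then show ?thesis using assms by (simp add: inverse_ennreal ennreal_leI le_imp_inverse_le)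
next
  case False
  then have "ennreal x = 0" by (simp add: ennreal_neg)
  then show ?thesis by simp
qed

lemma sin_ge_third:
  fixes x :: real
  assumes "0 \<le> x" "x \<le> 2"
  shows "x / 3 \<le> sin x"
proof -
  have "\<bar>sin x - (\<Sum>m<3. sin_coeff m * x ^ m)\<bar> \<le> inverse (fact 3) * \<bar>x\<bar> ^ 3"
    by (rule Maclaurin_sin_bound)
  then have "\<bar>sin x - x\<bar> \<le> x ^ 3 / 6"
    using assms by (simp add: sin_coeff_def fact_numeral eval_nat_numeral)
  moreover have "x ^ 3 \<le> 4 * x"
  proof -
    have "x * x \<le> 2 * 2" using assms by (intro mult_mono) auto
    then show ?thesis using mult_right_mono[of "x * x" 4 x] assms by (simp add: eval_nat_numeral mult_ac)
  qed
  ultimately show ?thesis by linarith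
qed

text \<open>The interval contains \<open>{0..pi}\<close>, which is half a period, and \<open>t / 6\<close> is a lower bound of
  \<open>sin (t / 2)\<close> there. In the extended nonnegative reals \<open>inverse 0 = \<infinity>\<close>, so this lower bound is
  usable at \<open>t = 0\<close> as well.\<close>
lemma nn_integral_inverse_sqrt:
  "(\<integral>\<^sup>+t. inverse (ennreal (sqrt (t / 6))) * indicator {0..4} t \<partial>lborel) < \<infinity>"
proof -
  define f :: "real \<Rightarrow> real" where "f t = (if t \<in> {0..4} then sqrt 6 * t powr (-1/2) else 0)" for t
  have [measurable]: "f \<in> borel_measurable borel" unfolding f_def by measurable
  have "(\<lambda>t. t powr (-1/2)) integrable_on {0..4::real}"
    using has_integral_powr_from_0[of "-1/2" 4] by (auto simp: integrable_on_def)
  then have "(\<lambda>t. sqrt 6 * t powr (-1/2)) integrable_on {0..4::real}"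
    by (rule integrable_on_mult_right)
  then have "f integrable_on UNIV"
    unfolding f_def by (subst integrable_restrict_UNIV)
  then obtain J where "(f has_integral J) UNIV" by (auto simp: integrable_on_def)
  moreover have "0 \<le> f t" for t by (simp add: f_def)
  ultimately have "(\<integral>\<^sup>+t. ennreal (f t) \<partial>lborel) = ennreal J"
    by (intro nn_integral_has_integral_lborel) auto
  moreover have "(\<integral>\<^sup>+t. inverse (ennreal (sqrt (t / 6))) * indicator {0..4} t \<partial>lborel)
     = (\<integral>\<^sup>+t. ennreal (f t) \<partial>lborel)"
    \<comment> \<open>At \<open>t = 0\<close> the sides differ: \<open>0 powr (-1/2)\<close> is 0, not \<open>\<infinity>\<close>.\<close>
  proof (rule nn_integral_cong_AE, use AE_lborel_singleton[of "0::real"] in eventually_elim)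
    fix t :: real assume "t \<noteq> 0"
    show "inverse (ennreal (sqrt (t / 6))) * indicator {0..4} t = ennreal (f t)"
    proof (cases "t \<in> {0..4}")
      case True
      then have t: "0 < t" using \<open>t \<noteq> 0\<close> by auto
      then have "inverse (sqrt (t / 6)) = sqrt 6 * t powr (-1/2)"
        by (simp add: powr_minus powr_half_sqrt real_sqrt_divide field_simps)
      then show ?thesis using True t by (simp add: f_def inverse_ennreal)
    qed (auto simp: f_def)
  qed
  ultimately show ?thesis by simp
qed

lemma nn_integral_inverse_sqrt_sin:
  "(\<integral>\<^sup>+t. inverse (ennreal (sqrt \<bar>sin (t / 2)\<bar>)) * indicator {0..<2*pi} t \<partial>lborel) < \<infinity>"
proof -
  define K :: "real \<Rightarrow> ennreal" where "K t = inverse (ennreal (sqrt (t / 6))) * indicator {0..4} t" for t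
  have [measurable]: "K \<in> borel_measurable borel" unfolding K_def by measurable
  have *: "inverse (ennreal (sqrt \<bar>sin (t / 2)\<bar>)) \<le> K t" if "0 \<le> t" "t \<le> 4" for t
  proof -
    have "sqrt (t / 6) \<le> sqrt \<bar>sin (t / 2)\<bar>"
      using sin_ge_third[of "t / 2"] that by (intro real_sqrt_le_mono) linarith
    then show ?thesis using that by (simp add: K_def inverse_ennreal_antimono)
  qed
  \<comment> \<open>The second half of the period is the mirror image of the first.\<close>
  have "inverse (ennreal (sqrt \<bar>sin (t / 2)\<bar>)) * indicator {0..<2*pi} t \<le> K t + K (2*pi + (-1) * t)" for t
  proof (cases "t \<in> {0..<2*pi}")
    case True
    show ?thesis
    proof (cases "t \<le> pi")
      case True
      then have "inverse (ennreal (sqrt \<bar>sin (t / 2)\<bar>)) \<le> K t"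
        using \<open>t \<in> _\<close> pi_less_4 by (intro *) auto
      then show ?thesis using \<open>t \<in> _\<close> by (simp add: add_increasing2)
    next
      case False
      have "sin (t / 2) = sin ((2*pi + (-1) * t) / 2)"
        by (simp add: diff_divide_distrib)
      moreover have "inverse (ennreal (sqrt \<bar>sin ((2*pi + (-1) * t) / 2)\<bar>)) \<le> K (2*pi + (-1) * t)"
        using False \<open>t \<in> _\<close> pi_less_4 by (intro *) auto
      ultimately show ?thesis using \<open>t \<in> _\<close> by (simp add: add_increasing)
    qed
  qed simp
  then have "(\<integral>\<^sup>+t. inverse (ennreal (sqrt \<bar>sin (t / 2)\<bar>)) * indicator {0..<2*pi} t \<partial>lborel)
      \<le> (\<integral>\<^sup>+t. K t + K (2*pi + (-1) * t) \<partial>lborel)"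
    by (rule nn_integral_mono)
  also have "\<dots> = (\<integral>\<^sup>+t. K t \<partial>lborel) + (\<integral>\<^sup>+t. K (2*pi + (-1) * t) \<partial>lborel)"
    by (rule nn_integral_add) auto
  also have "(\<integral>\<^sup>+t. K (2*pi + (-1) * t) \<partial>lborel) = (\<integral>\<^sup>+t. K t \<partial>lborel)"
    by (subst (2) nn_integral_real_affine[where c = "-1" and t = "2*pi"]) auto
  also have "(\<integral>\<^sup>+t. K t \<partial>lborel) + (\<integral>\<^sup>+t. K t \<partial>lborel) < \<infinity>"
    using nn_integral_inverse_sqrt by (simp add: K_def)
  finally show ?thesis .
qed

lemma nn_integral_inverse_sqrt_sin_int:
  fixes p :: int
  assumes "p \<noteq> 0"
  shows "(\<integral>\<^sup>+t. inverse (ennreal (sqrt \<bar>sin (of_int p * t / 2)\<bar>)) * indicator {0..<2*pi} t \<partial>lborel)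
    = (\<integral>\<^sup>+t. inverse (ennreal (sqrt \<bar>sin (t / 2)\<bar>)) * indicator {0..<2*pi} t \<partial>lborel)"
proof -
  have "\<bar>sin (of_int p * t / 2)\<bar> = \<bar>sin (real (nat \<bar>p\<bar>) * t / 2)\<bar>" for t
    by (cases "p \<ge> 0") auto
  moreover have "\<bar>sin ((t + 2 * pi) / 2)\<bar> = \<bar>sin (t / 2)\<bar>" for t
    by (simp add: add_divide_distrib)
  ultimately show ?thesis
    using nn_integral_periodic_scale[of "\<lambda>t. inverse (ennreal (sqrt \<bar>sin (t / 2)\<bar>))" "nat \<bar>p\<bar>"] assms
    by simp
qed

text \<open>The factor by which forming the invariance defect at \<open>b = cis t\<close> multiplies the \<open>n\<close>-th Fourier
  coefficient; see \<open>fourier_coeff_invariance_defect\<close>.\<close>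
definition multiplier :: "int \<Rightarrow> int \<Rightarrow> real \<Rightarrow> int \<Rightarrow> real"
  where "multiplier \<alpha> \<beta> t n =
    2 * cos ((of_int \<alpha> + of_int \<beta>) / 2 * t - of_int n * t) - 2 * cos ((of_int \<alpha> - of_int \<beta>) / 2 * t)"

lemma multiplier_eq_sin:
  "\<bar>multiplier \<alpha> \<beta> t n\<bar> = 4 * \<bar>sin (of_int (n - \<alpha>) * t / 2)\<bar> * \<bar>sin (of_int (n - \<beta>) * t / 2)\<bar>"
proof -
  let ?w = "(of_int \<alpha> + of_int \<beta>) / 2 * t - of_int n * t" and ?z = "(of_int \<alpha> - of_int \<beta>) / 2 * t"
  have "(?w + ?z) / 2 = - (of_int (n - \<alpha>) * t / 2)" "(?z - ?w) / 2 = of_int (n - \<beta>) * t / 2"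
    by (simp_all add: field_simps)
  then have "cos ?w - cos ?z = 2 * sin (- (of_int (n - \<alpha>) * t / 2)) * sin (of_int (n - \<beta>) * t / 2)"
    by (simp only: cos_diff_cos)
  then show ?thesis
    by (simp add: multiplier_def abs_mult right_diff_distrib[symmetric] del: of_int_diff)
qed

lemma multiplier_self [simp]: "multiplier \<alpha> \<beta> t \<alpha> = 0" "multiplier \<alpha> \<beta> t \<beta> = 0"
  using multiplier_eq_sin[of \<alpha> \<beta> t \<alpha>] multiplier_eq_sin[of \<alpha> \<beta> t \<beta>] by simp_all

lemma measurable_multiplier [measurable]: "(\<lambda>t. multiplier \<alpha> \<beta> t n) \<in> borel_measurable borel"
  unfolding multiplier_def by measurable

text \<open>The power \<open>-1/4\<close> of the absolute value of the multiplier, with value \<open>\<infinity>\<close> where the multiplier is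
  zero. The multiplier is a product of two sines, which may be small for the same \<open>t\<close>; the exponent leaves
  each of them with the power \<open>-1/2\<close> in the worst case, and that is integrable.\<close>
definition penalty :: "int \<Rightarrow> int \<Rightarrow> real \<Rightarrow> int \<Rightarrow> ennreal"
  where "penalty \<alpha> \<beta> t n = inverse (ennreal (sqrt (sqrt \<bar>multiplier \<alpha> \<beta> t n\<bar>)))"

lemma measurable_penalty [measurable]: "(\<lambda>t. penalty \<alpha> \<beta> t n) \<in> borel_measurable borel"
  unfolding penalty_def by measurable

lemma penalty_le:
  "penalty \<alpha> \<beta> t n \<le> inverse (ennreal (sqrt \<bar>sin (of_int (n - \<alpha>) * t / 2)\<bar>))
     + inverse (ennreal (sqrt \<bar>sin (of_int (n - \<beta>) * t / 2)\<bar>))"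
proof -
  have *: "sqrt (min x y) \<le> sqrt (sqrt (4 * x * y))" if "0 \<le> x" "0 \<le> y" for x y :: real
  proof (rule real_sqrt_le_mono, rule real_le_rsqrt)
    have "min x y * min x y \<le> x * y"
      using that by (intro mult_mono) auto
    then show "(min x y)\<^sup>2 \<le> 4 * x * y"
      using mult_nonneg_nonneg[OF that] unfolding power2_eq_square mult.assoc by linarith
  qed
  let ?x = "\<bar>sin (of_int (n - \<alpha>) * t / 2)\<bar>" and ?y = "\<bar>sin (of_int (n - \<beta>) * t / 2)\<bar>"
  have "penalty \<alpha> \<beta> t n \<le> inverse (ennreal (sqrt (min ?x ?y)))"
    unfolding penalty_def multiplier_eq_sin by (intro inverse_ennreal_antimono *) auto
  also have "\<dots> \<le> inverse (ennreal (sqrt ?x)) + inverse (ennreal (sqrt ?y))"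
    by (cases "?x \<le> ?y") (auto simp: min_def add_increasing add_increasing2)
  finally show ?thesis .
qed

lemma nn_integral_penalty_bounded:
  obtains C where "C < \<infinity>"
    "\<And>n. n \<noteq> \<alpha> \<Longrightarrow> n \<noteq> \<beta> \<Longrightarrow> (\<integral>\<^sup>+t. penalty \<alpha> \<beta> t n * indicator {0..<2*pi} t \<partial>lborel) \<le> C"
proof -
  define K where "K = (\<integral>\<^sup>+t. inverse (ennreal (sqrt \<bar>sin (t / 2)\<bar>)) * indicator {0..<2*pi} t \<partial>lborel)"
  have "(\<integral>\<^sup>+t. penalty \<alpha> \<beta> t n * indicator {0..<2*pi} t \<partial>lborel) \<le> K + K" if n: "n \<noteq> \<alpha>" "n \<noteq> \<beta>" for n
  proof -
    have "(\<integral>\<^sup>+t. penalty \<alpha> \<beta> t n * indicator {0..<2*pi} t \<partial>lborel)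
      \<le> (\<integral>\<^sup>+t. inverse (ennreal (sqrt \<bar>sin (of_int (n - \<alpha>) * t / 2)\<bar>)) * indicator {0..<2*pi} t
          + inverse (ennreal (sqrt \<bar>sin (of_int (n - \<beta>) * t / 2)\<bar>)) * indicator {0..<2*pi} t \<partial>lborel)"
      unfolding distrib_right[symmetric] by (intro nn_integral_mono mult_right_mono penalty_le) simp
    also have "\<dots> = K + K"
      using n by (subst nn_integral_add) (auto simp: K_def nn_integral_inverse_sqrt_sin_int simp del: of_int_diff)
    finally show ?thesis .
  qed
  moreover have "K + K < \<infinity>" using nn_integral_inverse_sqrt_sin by (simp add: K_def)
  ultimately show ?thesis by (intro that)
qed

text \<open>By Tonelli, the weighted sum of the penalties has a finite integral over \<open>{0..<2*pi}\<close>, so it cannot be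
  infinite everywhere.\<close>
lemma exists_penalty_sum_finite:
  fixes W :: "int \<Rightarrow> ennreal"
  assumes W: "(\<integral>\<^sup>+n. W n \<partial>count_space UNIV) < \<infinity>" "W \<alpha> = 0" "W \<beta> = 0"
  shows "\<exists>t\<in>{0..<2*pi}. (\<integral>\<^sup>+n. W n * penalty \<alpha> \<beta> t n \<partial>count_space UNIV) < \<infinity>"
proof (rule ccontr)
  assume "\<not> ?thesis"
  then have inf: "(\<integral>\<^sup>+n. W n * penalty \<alpha> \<beta> t n \<partial>count_space UNIV) = \<infinity>" if "t \<in> {0..<2*pi}" for t
    using that by (auto simp: less_top[symmetric])
  obtain C where C: "C < \<infinity>"
    "\<And>n. n \<noteq> \<alpha> \<Longrightarrow> n \<noteq> \<beta> \<Longrightarrow> (\<integral>\<^sup>+t. penalty \<alpha> \<beta> t n * indicator {0..<2*pi} t \<partial>lborel) \<le> C"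
    using nn_integral_penalty_bounded by blast
  have "\<infinity> = (\<integral>\<^sup>+t. \<infinity> * indicator {0..<2*pi} t \<partial>lborel)"
    by (subst nn_integral_cmult_indicator) (auto simp: ennreal_top_mult)
  also have "\<dots> = (\<integral>\<^sup>+t. (\<integral>\<^sup>+n. W n * (penalty \<alpha> \<beta> t n * indicator {0..<2*pi} t) \<partial>count_space UNIV) \<partial>lborel)"
  proof (intro nn_integral_cong)
    fix t :: real
    have "(\<integral>\<^sup>+n. W n * (penalty \<alpha> \<beta> t n * indicator {0..<2*pi} t) \<partial>count_space UNIV)
        = (\<integral>\<^sup>+n. W n * penalty \<alpha> \<beta> t n \<partial>count_space UNIV) * indicator {0..<2*pi} t"
      by (subst nn_integral_multc[symmetric]) (auto simp: mult.assoc)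
    then show "\<infinity> * indicator {0..<2*pi} t
        = (\<integral>\<^sup>+n. W n * (penalty \<alpha> \<beta> t n * indicator {0..<2*pi} t) \<partial>count_space UNIV)"
      using inf[of t] by (auto simp: indicator_def)
  qed
  also have "\<dots> = (\<integral>\<^sup>+n. (\<integral>\<^sup>+t. W n * (penalty \<alpha> \<beta> t n * indicator {0..<2*pi} t) \<partial>lborel) \<partial>count_space UNIV)"
    by (rule nn_integral_count_space_nn_integral) auto
  also have "\<dots> \<le> (\<integral>\<^sup>+n. W n * C \<partial>count_space UNIV)"
  proof (intro nn_integral_mono)
    fix n :: int
    have "(\<integral>\<^sup>+t. W n * (penalty \<alpha> \<beta> t n * indicator {0..<2*pi} t) \<partial>lborel)
      = W n * (\<integral>\<^sup>+t. penalty \<alpha> \<beta> t n * indicator {0..<2*pi} t \<partial>lborel)"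
      by (rule nn_integral_cmult) auto
    also have "\<dots> \<le> W n * C"
      using C(2)[of n] W(2,3) by (cases "n = \<alpha> \<or> n = \<beta>") (auto intro: mult_left_mono)
    finally show "(\<integral>\<^sup>+t. W n * (penalty \<alpha> \<beta> t n * indicator {0..<2*pi} t) \<partial>lborel) \<le> W n * C" .
  qed
  also have "\<dots> = (\<integral>\<^sup>+n. W n \<partial>count_space UNIV) * C"
    by (rule nn_integral_multc) auto
  also have "\<dots> < \<infinity>"
    using W(1) C(1) by (simp add: ennreal_mult_less_top)
  finally show False by simp
qed

lemma exists_penalty_prod_sum_finite:
  fixes W :: "int \<Rightarrow> ennreal" and k :: nat
  assumes W: "(\<integral>\<^sup>+n. W n \<partial>count_space UNIV) < \<infinity>" "W \<alpha> = 0" "W \<beta> = 0"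
  shows "\<exists>t. range t \<subseteq> {0..<2*pi} \<and>
    (\<integral>\<^sup>+n. W n * (\<Prod>j<k. penalty \<alpha> \<beta> (t j) n) \<partial>count_space UNIV) < \<infinity>"
proof (induction k)
  case 0
  show ?case using W by (intro exI[of _ "\<lambda>_. 0"]) auto
next
  case (Suc k)
  then obtain t where t: "range t \<subseteq> {0..<2*pi}"
    "(\<integral>\<^sup>+n. W n * (\<Prod>j<k. penalty \<alpha> \<beta> (t j) n) \<partial>count_space UNIV) < \<infinity>" by blast
  obtain s where s: "s \<in> {0..<2*pi}"
    "(\<integral>\<^sup>+n. W n * (\<Prod>j<k. penalty \<alpha> \<beta> (t j) n) * penalty \<alpha> \<beta> s n \<partial>count_space UNIV) < \<infinity>"
    using exists_penalty_sum_finite[OF t(2), of \<alpha> \<beta>] W by auto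
  have "(\<Prod>j<Suc k. penalty \<alpha> \<beta> ((t(k := s)) j) n) = (\<Prod>j<k. penalty \<alpha> \<beta> (t j) n) * penalty \<alpha> \<beta> s n" for n
    by (simp add: mult.commute)
  then show ?case
    using t s by (intro exI[of _ "t(k := s)"]) (auto simp: mult.assoc)
qed

text \<open>Each term of \<open>c\<close> is divided by that of its eight multipliers which is largest in absolute value.
  The number eight comes from the exponent \<open>-1/4\<close> of the penalty: a product of eight penalties is at
  least the power \<open>-2\<close> of this largest absolute value.\<close>
lemma square_summable_multiplier_decomposition:
  fixes c :: "int \<Rightarrow> complex"
  assumes c: "(\<lambda>n. (cmod (c n))\<^sup>2) summable_on UNIV" and c0: "c \<alpha> = 0" "c \<beta> = 0"
  obtains t :: "nat \<Rightarrow> real" and d :: "nat \<Rightarrow> int \<Rightarrow> complex" where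
    "\<And>j. t j \<in> {0..<2*pi}" "\<And>j. (\<lambda>n. (cmod (d j n))\<^sup>2) summable_on UNIV"
    "\<And>n. c n = (\<Sum>j<8. complex_of_real (multiplier \<alpha> \<beta> (t j) n) * d j n)"
proof -
  define W where "W n = ennreal ((cmod (c n))\<^sup>2)" for n
  have "integrable (count_space UNIV) (\<lambda>n. (cmod (c n))\<^sup>2)"
    using c abs_summable_equivalent[of "\<lambda>n. (cmod (c n))\<^sup>2" UNIV] by (simp add: abs_summable_on_def)
  then have "(\<integral>\<^sup>+n. W n \<partial>count_space UNIV) < \<infinity>"
    unfolding W_def by (simp add: integrable_iff_bounded)
  then obtain t :: "nat \<Rightarrow> real" where t: "range t \<subseteq> {0..<2*pi}"
    and fin: "(\<integral>\<^sup>+n. W n * (\<Prod>j<8. penalty \<alpha> \<beta> (t j) n) \<partial>count_space UNIV) < \<infinity>"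
    using exists_penalty_prod_sum_finite[of W \<alpha> \<beta> 8] c0 by (auto simp: W_def)
  define m where "m j n = \<bar>multiplier \<alpha> \<beta> (t j) n\<bar>" for j n
  have "\<exists>i<8. \<forall>j<8. m j n \<le> m i n" for n
  proof -
    have "Max ((\<lambda>j. m j n) ` {..<8::nat}) \<in> (\<lambda>j. m j n) ` {..<8}"
      by (rule Max_in) (auto simp: lessThan_empty_iff)
    then obtain i where "i < 8" "m i n = Max ((\<lambda>j. m j n) ` {..<8::nat})" by auto
    then show ?thesis by (intro exI[of _ i]) auto
  qed
  then obtain J :: "int \<Rightarrow> nat" where J: "\<And>n. J n < 8" "\<And>n j. j < 8 \<Longrightarrow> m j n \<le> m (J n) n"
    by metis
  have pen: "inverse (ennreal ((m (J n) n)\<^sup>2)) \<le> (\<Prod>j<8. penalty \<alpha> \<beta> (t j) n)" for n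
  proof -
    let ?x = "m (J n) n"
    have x: "0 \<le> ?x" by (simp add: m_def)
    have "(sqrt (sqrt ?x)) ^ 8 = ((sqrt (sqrt ?x))\<^sup>2)\<^sup>2 * ((sqrt (sqrt ?x))\<^sup>2)\<^sup>2"
      by (simp add: power_add[symmetric] power_mult[symmetric])
    also have "\<dots> = ?x\<^sup>2"
      using x by (simp add: power2_eq_square)
    finally have "ennreal (?x\<^sup>2) = ennreal (sqrt (sqrt ?x)) ^ 8"
      using x by (simp add: ennreal_power)
    then have "inverse (ennreal (?x\<^sup>2)) = (\<Prod>j<8::nat. inverse (ennreal (sqrt (sqrt ?x))))"
      by (simp add: ennreal_inverse_power)
    also have "\<dots> \<le> (\<Prod>j<8. penalty \<alpha> \<beta> (t j) n)"
      unfolding penalty_def using J(2)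
      by (intro prod_mono_ennreal inverse_ennreal_antimono real_sqrt_le_mono) (auto simp: m_def)
    finally show ?thesis .
  qed
  have ne: "\<forall>n. W n * (\<Prod>j<8. penalty \<alpha> \<beta> (t j) n) \<noteq> \<infinity>"
    using nn_integral_PInf_AE[OF _ less_imp_neq[OF fin]] by (simp add: AE_count_space)
  have nz: "multiplier \<alpha> \<beta> (t (J n)) n \<noteq> 0" if "c n \<noteq> 0" for n
  proof
    assume "multiplier \<alpha> \<beta> (t (J n)) n = 0"
    then have "(\<Prod>j<8. penalty \<alpha> \<beta> (t j) n) = \<infinity>"
      using pen[of n] by (simp add: m_def top_unique)
    moreover have "W n \<noteq> 0" using that by (simp add: W_def)
    ultimately show False using ne[rule_format, of n] by (simp add: ennreal_mult_top)
  qed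
  define d where "d j n = (if j = J n then c n / complex_of_real (multiplier \<alpha> \<beta> (t j) n) else 0)" for j n
  show ?thesis
  proof (rule that[of t d])
    show "t j \<in> {0..<2*pi}" for j using t by (rule range_subsetD)
    show "c n = (\<Sum>j<8. complex_of_real (multiplier \<alpha> \<beta> (t j) n) * d j n)" for n
    proof -
      have "(\<Sum>j<8. complex_of_real (multiplier \<alpha> \<beta> (t j) n) * d j n) = (\<Sum>j<8. if j = J n then c n else 0)"
        using nz[of n] by (intro sum.cong) (auto simp: d_def)
      then show ?thesis using J(1)[of n] by simp
    qed
    show "(\<lambda>n. (cmod (d j n))\<^sup>2) summable_on UNIV" for j
    proof -
      have "ennreal ((cmod (d j n))\<^sup>2) \<le> W n * (\<Prod>j<8. penalty \<alpha> \<beta> (t j) n)" for n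
      proof (cases "j = J n \<and> c n \<noteq> 0")
        case True
        then have "0 < m j n" using nz[of n] by (simp add: m_def)
        then have "ennreal ((cmod (d j n))\<^sup>2) = W n * inverse (ennreal ((m (J n) n)\<^sup>2))"
          using True by (simp add: d_def W_def m_def inverse_ennreal divide_inverse norm_mult norm_inverse
              power_mult_distrib power_inverse ennreal_mult'[symmetric])
        also have "\<dots> \<le> W n * (\<Prod>j<8. penalty \<alpha> \<beta> (t j) n)"
          by (intro mult_left_mono pen) simp
        finally show ?thesis .
      qed (auto simp: d_def)
      then have "(\<integral>\<^sup>+n. ennreal ((cmod (d j n))\<^sup>2) \<partial>count_space UNIV)
          \<le> (\<integral>\<^sup>+n. W n * (\<Prod>j<8. penalty \<alpha> \<beta> (t j) n) \<partial>count_space UNIV)"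
        by (intro nn_integral_mono)
      also note fin
      finally have "integrable (count_space UNIV) (\<lambda>n. (cmod (d j n))\<^sup>2)"
        by (intro integrableI_bounded) auto
      then show ?thesis
        using abs_summable_equivalent[of "\<lambda>n. (cmod (d j n))\<^sup>2" UNIV] by (simp add: abs_summable_on_def)
    qed
  qed
qed

section \<open>Invariant linear forms\<close>

lemma cis_Arg2pi: "b \<in> circle \<Longrightarrow> cis (Arg2pi b) = b"
  using Arg2pi_eq[of b] by (simp add: cis_conv_exp)

lemma circle_powr_of_int:
  assumes "z \<in> circle" shows "circle_powr z (of_int n) = z powi n"
proof -
  have "circle_powr z (of_int n) = cis (Arg2pi z) powi n"
    by (simp add: circle_powr_def cis_power_int)
  then show ?thesis by (simp only: cis_Arg2pi[OF assms])
qed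

lemma circle_powr_cis:
  assumes "t \<in> {0..<2*pi}" shows "circle_powr (cis t) \<nu> = cis (\<nu> * t)"
proof -
  have "Arg2pi (cis t) = t"
    by (rule Arg2pi_unique[of 1]) (use assms in \<open>auto simp: cis_conv_exp\<close>)
  then show ?thesis by (simp add: circle_powr_def)
qed

text \<open>The difference of the two functions at which an \<open>(\<alpha>, \<beta>)\<close>-invariant form has to agree, for given
  \<open>b\<close> and \<open>f\<close>.\<close>
definition invariance_defect :: "int \<Rightarrow> int \<Rightarrow> complex \<Rightarrow> (complex \<Rightarrow> complex) \<Rightarrow> complex \<Rightarrow> complex"
  where "invariance_defect \<alpha> \<beta> b f = (\<lambda>z.
    (circle_powr b ((of_int \<alpha> + of_int \<beta>) / 2) * dirac_conv b f z
      + circle_powr b (- ((of_int \<alpha> + of_int \<beta>) / 2)) * dirac_conv (inverse b) f z)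
    - (circle_powr b ((of_int \<alpha> - of_int \<beta>) / 2) + circle_powr b (- ((of_int \<alpha> - of_int \<beta>) / 2))) * f z)"

lemma L2_dirac_conv_combination:
  assumes "f \<in> L2_circle" "b \<in> circle"
  shows "(\<lambda>z. x * dirac_conv b f z + y * dirac_conv (inverse b) f z) \<in> L2_circle"
  using assms by (intro L2_add L2_cmult dirac_conv_L2) (auto simp: norm_inverse)

lemma L2_invariance_defect:
  assumes "f \<in> L2_circle" "b \<in> circle"
  shows "invariance_defect \<alpha> \<beta> b f \<in> L2_circle"
  unfolding invariance_defect_def
  by (intro L2_diff L2_dirac_conv_combination L2_cmult assms)

lemma fourier_coeff_invariance_defect:
  assumes f: "f \<in> L2_circle" and t: "t \<in> {0..<2*pi}"
  shows "fourier_coeff (invariance_defect \<alpha> \<beta> (cis t) f) n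
    = complex_of_real (multiplier \<alpha> \<beta> t n) * fourier_coeff f n"
proof -
  let ?s = "(of_int \<alpha> + of_int \<beta>) / 2 :: real" and ?a = "(of_int \<alpha> - of_int \<beta>) / 2 :: real"
  have b: "cis t \<in> circle" "inverse (cis t) \<in> circle" by (auto simp: norm_inverse)
  have two_cos: "cis x + cis (- x) = complex_of_real (2 * cos x)" for x
    by (simp add: complex_eq_iff)
  have "fourier_coeff (invariance_defect \<alpha> \<beta> (cis t) f) n
    = cis (?s * t) * (cis t powi (- n) * fourier_coeff f n)
      + cis (- (?s * t)) * (inverse (cis t) powi (- n) * fourier_coeff f n)
      - (cis (?a * t) + cis (- (?a * t))) * fourier_coeff f n"
    unfolding invariance_defect_def using f b t
    by (simp add: fourier_coeff_diff fourier_coeff_add fourier_coeff_cmult L2_dirac_conv_combination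
        L2_cmult L2_add dirac_conv_L2 fourier_coeff_dirac_conv circle_powr_cis
        del: cis_inverse)
  also have "\<dots> = (cis (?s * t) * cis t powi (- n) + cis (- (?s * t)) * inverse (cis t) powi (- n)
      - (cis (?a * t) + cis (- (?a * t)))) * fourier_coeff f n"
    by (simp only: mult.assoc distrib_right left_diff_distrib)
  also have "cis (?s * t) * cis t powi (- n) = cis (?s * t - of_int n * t)"
    by (simp add: cis_power_int cis_mult)
  also have "cis (- (?s * t)) * inverse (cis t) powi (- n) = cis (- (?s * t - of_int n * t))"
    by (simp add: cis_power_int cis_mult)
  finally show ?thesis
    by (simp only: two_cos multiplier_def of_real_diff)
qed

lemma linear_form_L2_add:
  "linear_form_L2 L \<Longrightarrow> f \<in> L2_circle \<Longrightarrow> g \<in> L2_circle \<Longrightarrow> L (\<lambda>z. f z + g z) = L f + L g"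
  unfolding linear_form_L2_def by blast

lemma linear_form_L2_cmult:
  "linear_form_L2 L \<Longrightarrow> f \<in> L2_circle \<Longrightarrow> L (\<lambda>z. c * f z) = c * L f"
  unfolding linear_form_L2_def by blast

lemma linear_form_L2_cong:
  "linear_form_L2 L \<Longrightarrow> f \<in> L2_circle \<Longrightarrow> g \<in> L2_circle \<Longrightarrow>
    (AE z in haar_circle. f z = g z) \<Longrightarrow> L f = L g"
  unfolding linear_form_L2_def by blast

lemma linear_form_L2_diff:
  assumes "linear_form_L2 L" "f \<in> L2_circle" "g \<in> L2_circle"
  shows "L (\<lambda>z. f z - g z) = L f - L g"
proof -
  have "L (\<lambda>z. f z + (-1) * g z) = L f + L (\<lambda>z. (-1) * g z)"
    by (rule linear_form_L2_add[OF assms(1,2) L2_cmult[OF assms(3)]])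
  also have "L (\<lambda>z. (-1) * g z) = (-1) * L g"
    by (rule linear_form_L2_cmult[OF assms(1,3)])
  finally show ?thesis by simp
qed

lemma linear_form_L2_sum:
  assumes L: "linear_form_L2 L" and "finite I" "\<And>i. i \<in> I \<Longrightarrow> f i \<in> L2_circle"
  shows "L (\<lambda>z. \<Sum>i\<in>I. f i z) = (\<Sum>i\<in>I. L (f i))"
  using assms(2,3)
proof (induction I rule: finite_induct)
  case empty
  have "L (\<lambda>z. 0 * z powi 0) = 0 * L (\<lambda>z. z powi 0)"
    by (rule linear_form_L2_cmult[OF L L2_powi])
  then show ?case by simp
next
  case (insert i I)
  then show ?case using linear_form_L2_add[OF L, of "f i" "\<lambda>z. \<Sum>i\<in>I. f i z"] by (simp add: L2_sum)
qed

lemma invariant_form_iff: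
  assumes L: "linear_form_L2 L"
  shows "invariant_form (of_int \<alpha>) (of_int \<beta>) L
    \<longleftrightarrow> (\<forall>t\<in>{0..<2*pi}. \<forall>f\<in>L2_circle. L (invariance_defect \<alpha> \<beta> (cis t) f) = 0)"
proof -
  have circle: "circle = cis ` {0..<2*pi}"
  proof (intro equalityI subsetI)
    fix b assume "b \<in> circle"
    then show "b \<in> cis ` {0..<2*pi}"
      using Arg2pi_ge_0[of b] Arg2pi_lt_2pi[of b] by (intro image_eqI[of _ _ "Arg2pi b"]) (auto simp: cis_Arg2pi)
  qed auto
  have "L (invariance_defect \<alpha> \<beta> b f)
     = L (\<lambda>z. circle_powr b ((of_int \<alpha> + of_int \<beta>) / 2) * dirac_conv b f z
            + circle_powr b (- ((of_int \<alpha> + of_int \<beta>) / 2)) * dirac_conv (inverse b) f z)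
       - (circle_powr b ((of_int \<alpha> - of_int \<beta>) / 2) + circle_powr b (- ((of_int \<alpha> - of_int \<beta>) / 2))) * L f"
    if "b \<in> circle" "f \<in> L2_circle" for b f
    unfolding invariance_defect_def linear_form_L2_diff[OF L L2_dirac_conv_combination[OF that(2,1)] L2_cmult[OF that(2)]]
    by (simp add: linear_form_L2_cmult[OF L that(2)])
  then have "invariant_form (of_int \<alpha>) (of_int \<beta>) L
      \<longleftrightarrow> (\<forall>b\<in>circle. \<forall>f\<in>L2_circle. L (invariance_defect \<alpha> \<beta> b f) = 0)"
    unfolding invariant_form_def by auto
  then show ?thesis unfolding circle by simp
qed

text \<open>Almost everywhere, \<open>f\<close> is a sum of eight invariance defects. Since that sum is finite, linearity of
  the form suffices and continuity plays no role.\<close>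
lemma invariant_form_eq_0:
  assumes L: "linear_form_L2 L" and inv: "invariant_form (of_int \<alpha>) (of_int \<beta>) L"
    and f: "f \<in> L2_circle" "fourier_coeff f \<alpha> = 0" "fourier_coeff f \<beta> = 0"
  shows "L f = 0"
proof -
  obtain t :: "nat \<Rightarrow> real" and d where t: "\<And>j. t j \<in> {0..<2*pi}"
    and d: "\<And>j. (\<lambda>n. (cmod (d j n))\<^sup>2) summable_on UNIV"
    and sum: "\<And>n. fourier_coeff f n = (\<Sum>j<8. complex_of_real (multiplier \<alpha> \<beta> (t j) n) * d j n)"
    using square_summable_multiplier_decomposition[OF fourier_coeff_summable[OF f(1)] f(2,3)] by blast
  have "\<exists>g. g \<in> L2_circle \<and> (\<forall>n. fourier_coeff g n = d j n)" for j
    using Riesz_Fischer[OF d[of j]] by blast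
  then obtain g where g: "\<And>j. g j \<in> L2_circle" "\<And>j n. fourier_coeff (g j) n = d j n"
    by metis
  define u where "u j = invariance_defect \<alpha> \<beta> (cis (t j)) (g j)" for j
  have u: "u j \<in> L2_circle" for j
    unfolding u_def by (intro L2_invariance_defect g) simp
  have fu: "fourier_coeff (u j) n = complex_of_real (multiplier \<alpha> \<beta> (t j) n) * d j n" for j n
    by (simp add: u_def g fourier_coeff_invariance_defect[OF g(1) t])
  have "L f = L (\<lambda>z. \<Sum>j<8. u j z)"
  proof (rule linear_form_L2_cong[OF L f(1)])
    show "AE z in haar_circle. f z = (\<Sum>j<8. u j z)"
    proof (rule fourier_coeff_eq_AE[OF f(1)])
      show "fourier_coeff f n = fourier_coeff (\<lambda>z. \<Sum>j<8. u j z) n" for n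
        by (simp add: fourier_coeff_sum u sum fu)
    qed (intro L2_sum u)
  qed (intro L2_sum u)
  also have "\<dots> = (\<Sum>j<8. L (u j))"
    by (rule linear_form_L2_sum[OF L]) (auto simp: u)
  also have "\<dots> = 0"
    using inv t g unfolding invariant_form_iff[OF L] by (simp add: u_def)
  finally show ?thesis .
qed

proposition invariant_form_eq_fourier_coeff:
  assumes L: "linear_form_L2 L" and inv: "invariant_form (of_int \<alpha>) (of_int \<beta>) L"
  obtains a1 a2 where "\<And>f. f \<in> L2_circle \<Longrightarrow> L f = a1 * fourier_coeff f \<alpha> + a2 * fourier_coeff f \<beta>"
proof -
  define a1 where "a1 = L (\<lambda>z. z powi \<alpha>)"
  \<comment> \<open>If \<open>\<alpha> = \<beta>\<close>, the single coefficient must not be counted twice.\<close>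
  define a2 where "a2 = (if \<alpha> = \<beta> then 0 else L (\<lambda>z. z powi \<beta>))"
  show ?thesis
  proof (rule that)
    fix f assume f: "f \<in> L2_circle"
    define x y where "x = fourier_coeff f \<alpha>" and "y = (if \<alpha> = \<beta> then 0 else fourier_coeff f \<beta>)"
    let ?s = "\<lambda>z. x * z powi \<alpha> + y * z powi \<beta>"
    have s: "?s \<in> L2_circle" by (intro L2_add L2_cmult L2_powi)
    have "fourier_coeff (\<lambda>z. f z - ?s z) n = 0" if "n = \<alpha> \<or> n = \<beta>" for n
      using that f s
      by (auto simp: fourier_coeff_diff fourier_coeff_add fourier_coeff_cmult L2_cmult L2_powi
          fourier_coeff_powi x_def y_def)
    then have "L (\<lambda>z. f z - ?s z) = 0"
      by (intro invariant_form_eq_0[OF L inv] L2_diff f s) auto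
    then have "L f = L ?s"
      using linear_form_L2_diff[OF L f s] by simp
    also have "\<dots> = x * L (\<lambda>z. z powi \<alpha>) + y * L (\<lambda>z. z powi \<beta>)"
      by (simp add: linear_form_L2_add[OF L] linear_form_L2_cmult[OF L L2_powi] L2_cmult L2_powi)
    also have "\<dots> = a1 * fourier_coeff f \<alpha> + a2 * fourier_coeff f \<beta>"
      by (simp add: a1_def a2_def x_def y_def)
    finally show "L f = a1 * fourier_coeff f \<alpha> + a2 * fourier_coeff f \<beta>" .
  qed
qed

lemma norm_fourier_coeff_le:
  assumes "f \<in> L2_circle" shows "cmod (fourier_coeff f n) \<le> L2_norm f"
  using Bessel_inequality[OF assms, of "{n}"] by (auto simp: L2_norm_def intro: real_le_rsqrt)

lemma pairing_powi_combination:
  assumes f: "f \<in> L2_circle"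
  shows "(LINT z|haar_circle. f z * cnj (c1 * z powi \<alpha> + c2 * z powi \<beta>))
    = cnj c1 * fourier_coeff f \<alpha> + cnj c2 * fourier_coeff f \<beta>"
proof -
  have "(LINT z|haar_circle. f z * cnj (c1 * z powi \<alpha> + c2 * z powi \<beta>))
    = (LINT z|haar_circle. cnj c1 * (f z * cnj (z powi \<alpha>)) + cnj c2 * (f z * cnj (z powi \<beta>)))"
    by (simp add: algebra_simps)
  then show ?thesis
    using integrable_mult_powi[OF L2_integrable[OF f]] by (simp add: fourier_coeff_def)
qed

lemma continuous_L2_fourier_coeff:
  assumes L: "\<And>f. f \<in> L2_circle \<Longrightarrow> L f = a1 * fourier_coeff f \<alpha> + a2 * fourier_coeff f \<beta>"
  shows "continuous_L2 L"
  unfolding continuous_L2_def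
proof (intro ballI allI impI)
  fix f and e :: real
  assume f: "f \<in> L2_circle" and e: "0 < e"
  define C where "C = cmod a1 + cmod a2 + 1"
  have C: "0 < C" by (simp add: C_def add_nonneg_pos)
  show "\<exists>d>0. \<forall>g\<in>L2_circle. L2_norm (\<lambda>z. g z - f z) < d \<longrightarrow> cmod (L g - L f) < e"
  proof (intro exI[of _ "e / C"] conjI ballI impI)
    fix g assume g: "g \<in> L2_circle" and lt: "L2_norm (\<lambda>z. g z - f z) < e / C"
    let ?k = "\<lambda>z. g z - f z"
    have k: "?k \<in> L2_circle" by (rule L2_diff[OF g f])
    have "L g - L f = a1 * fourier_coeff ?k \<alpha> + a2 * fourier_coeff ?k \<beta>"
      by (simp add: L f g fourier_coeff_diff algebra_simps)
    also have "cmod \<dots> \<le> cmod a1 * cmod (fourier_coeff ?k \<alpha>) + cmod a2 * cmod (fourier_coeff ?k \<beta>)"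
      unfolding norm_mult[symmetric] by (rule norm_triangle_ineq)
    also have "\<dots> \<le> cmod a1 * L2_norm ?k + cmod a2 * L2_norm ?k"
      by (intro add_mono mult_left_mono norm_fourier_coeff_le k) auto
    also have "\<dots> \<le> C * L2_norm ?k"
      by (simp add: C_def algebra_simps L2_norm_def)
    also have "\<dots> < e"
      using lt C by (simp add: pos_less_divide_eq mult.commute)
    finally show "cmod (L g - L f) < e" .
  qed (use e C in simp)
qed

proposition invariant_pairing_iff:
  assumes h: "h \<in> L2_circle"
  shows "invariant_form (of_int \<alpha>) (of_int \<beta>) (\<lambda>f. LINT z|haar_circle. f z * cnj (h z))
    \<longleftrightarrow> (\<exists>c1 c2. AE z in haar_circle. h z = c1 * z powi \<alpha> + c2 * z powi \<beta>)"
    (is "invariant_form _ _ ?L \<longleftrightarrow> _")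
proof
  assume inv: "invariant_form (of_int \<alpha>) (of_int \<beta>) ?L"
  obtain a1 a2 where a: "\<And>f. f \<in> L2_circle \<Longrightarrow> ?L f = a1 * fourier_coeff f \<alpha> + a2 * fourier_coeff f \<beta>"
    by (rule invariant_form_eq_fourier_coeff[OF linear_form_pairing[OF h] inv]) (rule that)
  let ?s = "\<lambda>z. cnj a1 * z powi \<alpha> + cnj a2 * z powi \<beta>"
  have s: "?s \<in> L2_circle" by (intro L2_add L2_cmult L2_powi)
  have "fourier_coeff h n = fourier_coeff ?s n" for n
  proof -
    have conj: "fourier_coeff k n = cnj (LINT z|haar_circle. z powi n * cnj (k z))" for k
    proof -
      have "fourier_coeff k n = (LINT z|haar_circle. cnj (z powi n * cnj (k z)))"
        unfolding fourier_coeff_def by (simp only: complex_cnj_mult complex_cnj_cnj mult.commute)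
      also have "\<dots> = cnj (LINT z|haar_circle. z powi n * cnj (k z))"
        by (rule Bochner_Integration.integral_cnj)
      finally show ?thesis .
    qed
    show ?thesis
      unfolding conj a[OF L2_powi] pairing_powi_combination[OF L2_powi] by simp
  qed
  then have "AE z in haar_circle. h z = ?s z"
    by (rule fourier_coeff_eq_AE[OF h s])
  then show "\<exists>c1 c2. AE z in haar_circle. h z = c1 * z powi \<alpha> + c2 * z powi \<beta>" by blast
next
  assume "\<exists>c1 c2. AE z in haar_circle. h z = c1 * z powi \<alpha> + c2 * z powi \<beta>"
  then obtain c1 c2 where c: "AE z in haar_circle. h z = c1 * z powi \<alpha> + c2 * z powi \<beta>" by blast
  let ?s = "\<lambda>z. c1 * z powi \<alpha> + c2 * z powi \<beta>"
  have s: "?s \<in> L2_circle" by (intro L2_add L2_cmult L2_powi)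
  have "?L f = cnj c1 * fourier_coeff f \<alpha> + cnj c2 * fourier_coeff f \<beta>" if f: "f \<in> L2_circle" for f
  proof -
    have "?L f = (LINT z|haar_circle. f z * cnj (?s z))"
      using integrable_pairing[OF f h] integrable_pairing[OF f s] c
      by (intro integral_cong_AE borel_measurable_integrable) (auto elim: eventually_mono)
    then show ?thesis unfolding pairing_powi_combination[OF f] .
  qed
  then show "invariant_form (of_int \<alpha>) (of_int \<beta>) ?L"
    unfolding invariant_form_iff[OF linear_form_pairing[OF h]]
    by (simp add: L2_invariance_defect fourier_coeff_invariance_defect)
qed

lemma translation_invariant_imp_invariant:
  assumes L: "linear_form_L2 L" and inv: "translation_invariant_form L"
  shows "invariant_form (of_int 0) (of_int 0) L"
  unfolding invariant_form_def
proof (intro ballI)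
  fix b f assume b: "b \<in> circle" and f: "f \<in> L2_circle"
  have ib: "inverse b \<in> circle" using b by (simp add: norm_inverse)
  have "L (\<lambda>z. dirac_conv b f z + dirac_conv (inverse b) f z) = L f + L f"
    using linear_form_L2_add[OF L dirac_conv_L2[OF b f] dirac_conv_L2[OF ib f]] inv b ib f
    by (simp add: translation_invariant_form_def)
  then show "L (\<lambda>z. circle_powr b ((of_int 0 + of_int 0) / 2) * dirac_conv b f z
            + circle_powr b (- ((of_int 0 + of_int 0) / 2)) * dirac_conv (inverse b) f z)
       = (circle_powr b ((of_int 0 - of_int 0) / 2) + circle_powr b (- ((of_int 0 - of_int 0) / 2))) * L f"
    by (simp add: circle_powr_def)
qed

theorem theorem7p1:
  fixes \<alpha> \<beta> :: int and L :: "(complex \<Rightarrow> complex) \<Rightarrow> complex"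
  assumes "linear_form_L2 L"
  shows "(invariant_form (of_int \<alpha>) (of_int \<beta>) L \<longrightarrow>
            continuous_L2 L \<and>
            (\<exists>h\<in>L2_circle. \<forall>f\<in>L2_circle. L f = (LINT z|haar_circle. f z * cnj (h z)))) \<and>
         (\<forall>h\<in>L2_circle.
            invariant_form (of_int \<alpha>) (of_int \<beta>) (\<lambda>f. LINT z|haar_circle. f z * cnj (h z)) \<longleftrightarrow>
            (\<exists>c1 c2. AE z in haar_circle.
               h z = c1 * circle_powr z (of_int \<alpha>) + c2 * circle_powr z (of_int \<beta>))) \<and>
         (translation_invariant_form L \<longrightarrow>
            (\<exists>c. \<forall>f\<in>L2_circle. L f = c * (LINT z|haar_circle. f z)))"
proof (intro conjI impI ballI)
  assume "invariant_form (of_int \<alpha>) (of_int \<beta>) L"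
  then obtain a1 a2 where a: "\<And>f. f \<in> L2_circle \<Longrightarrow> L f = a1 * fourier_coeff f \<alpha> + a2 * fourier_coeff f \<beta>"
    using invariant_form_eq_fourier_coeff[OF assms] by metis
  show "continuous_L2 L" by (rule continuous_L2_fourier_coeff[OF a])
  show "\<exists>h\<in>L2_circle. \<forall>f\<in>L2_circle. L f = (LINT z|haar_circle. f z * cnj (h z))"
  proof (intro bexI[of _ "\<lambda>z. cnj a1 * z powi \<alpha> + cnj a2 * z powi \<beta>"] ballI)
    show "(\<lambda>z. cnj a1 * z powi \<alpha> + cnj a2 * z powi \<beta>) \<in> L2_circle"
      by (intro L2_add L2_cmult L2_powi)
  qed (simp only: a pairing_powi_combination complex_cnj_cnj)
next
  fix h assume h: "h \<in> L2_circle"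
  have "(AE z in haar_circle. h z = c1 * circle_powr z (of_int \<alpha>) + c2 * circle_powr z (of_int \<beta>))
      \<longleftrightarrow> (AE z in haar_circle. h z = c1 * z powi \<alpha> + c2 * z powi \<beta>)" for c1 c2
    by (rule AE_cong) (simp add: circle_powr_of_int)
  then show "invariant_form (of_int \<alpha>) (of_int \<beta>) (\<lambda>f. LINT z|haar_circle. f z * cnj (h z)) \<longleftrightarrow>
      (\<exists>c1 c2. AE z in haar_circle. h z = c1 * circle_powr z (of_int \<alpha>) + c2 * circle_powr z (of_int \<beta>))"
    using invariant_pairing_iff[OF h] by simp
next
  assume "translation_invariant_form L"
  then obtain a1 a2 where a: "\<And>f. f \<in> L2_circle \<Longrightarrow> L f = a1 * fourier_coeff f 0 + a2 * fourier_coeff f 0"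
    using invariant_form_eq_fourier_coeff[OF assms translation_invariant_imp_invariant[OF assms]] by metis
  show "\<exists>c. \<forall>f\<in>L2_circle. L f = c * (LINT z|haar_circle. f z)"
    by (intro exI[of _ "a1 + a2"] ballI) (simp add: a fourier_coeff_def distrib_right)
qed

end
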